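(* Let $(A,d_A)$ and $(B,d_B)$ be dg-algebras over some graded-commutative dg-division ring $(K,d_K)$ and suppose that $\varphi:(A,d_A)\to(B,d_B)$ is a dg-separable dg-extension. Then any short exact sequence of dg-modules $$0\longrightarrow(L,\delta_L)\stackrel{f}{\longrightarrow}(M,\delta_M)\stackrel{g}{\longrightarrow}(N,\delta_N)\longrightarrow 0$$ over $(B,d_B)$ is split if and only if it is split when considered, by restriction along $\varphi$, as a sequence of dg-modules over $(A,d_A)$.
   Context: A differential graded algebra (dg-algebra) $(A,d)$ is a $\mathbb{Z}$-graded unital associative algebra $A$ together with a graded additive endomorphism $d:A\to A$ of degree $1$ such that $d^2=0$ and $d(ab)=d(a)b+(-1)^{|a|}a\,d(b)$ for all homogeneous $a,b\in A$. It is graded commutative if $ab=(-1)^{|a||b|}ba$ for homogeneous $a,b$. A (left) dg-module over $(A,d)$ is a $\mathbb{Z}$-graded $A$-module $M$ with a graded additive endomorphism $\delta$ of degree $1$ with $\delta^2=0$ and $\delta(am)=d(a)m+(-1)^{|a|}a\,\delta(m)$ for homogeneous $a\in A$, $m\in M$. Morphisms of dg-modules are degree $0$ module homomorphisms commuting with the differentials; a short exact sequence of dg-modules is split if $g$ has a right inverse that is a morphism of dg-modules. A dg-division ring is a dg-algebra whose only graded left ideals stable under the differential, and only graded right ideals stable under the differential, are $0$ and the whole algebra. A dg-algebra over a graded commutative dg-division ring $(K,d_K)$ is a dg-algebra with a dg-algebra homomorphism from $(K,d_K)$ whose image lies in its graded centre. A dg-extension $\varphi:(A,d_A)\to(B,d_B)$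 is a homomorphism of dg-algebras (unital, degree $0$, commuting with differentials, compatible with the $K$-structures). A dg-extension $(A,d_A)\to(B,d_B)$ is dg-separable if the multiplication map $\mu:B\otimes_AB\to B$ is split as a morphism of differential graded $B$-$B$-bimodules, where $B\otimes_AB$ carries the differential $d(b\otimes b')=d_B(b)\otimes b'+(-1)^{|b|}b\otimes d_B(b')$ for homogeneous $b,b'$; that is, there is a degree $0$ bimodule homomorphism $\rho:B\to B\otimes_AB$ commuting with differentials with $\mu\circ\rho=\mathrm{id}_B$. *)

theory Defs
  imports "HOL-Algebra.Algebra"
begin

section \<open>Graded groups with a differential\<close>

text \<open>
  As with the record of modules in \<^theory>\<open>HOL-Algebra.Module\<close>, modules reuse the ring record and
  ignore its fields for multiplication and unit.  All functions are only relevant on carriers.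
\<close>

record 'a dg_ring = "'a ring" +
  homog :: "int \<Rightarrow> 'a set"
  diff :: "'a \<Rightarrow> 'a"

definition is_decomposition :: "('a, 'x) dg_ring_scheme \<Rightarrow> 'a \<Rightarrow> (int \<Rightarrow> 'a) \<Rightarrow> bool" where
  "is_decomposition M x c \<longleftrightarrow>
     (\<forall>i. c i \<in> homog M i) \<and> finite {i. c i \<noteq> \<zero>\<^bsub>M\<^esub>} \<and> x = finsum M c {i. c i \<noteq> \<zero>\<^bsub>M\<^esub>}"

definition component :: "('a, 'x) dg_ring_scheme \<Rightarrow> 'a \<Rightarrow> int \<Rightarrow> 'a" where
  "component M x = (THE c. is_decomposition M x c)"

definition koszul :: "('a, 'x) dg_ring_scheme \<Rightarrow> int \<Rightarrow> 'a \<Rightarrow> 'a" where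
  "koszul M n x = (if even n then x else \<ominus>\<^bsub>M\<^esub> x)"  \<comment> \<open>$(-1)^n x$\<close>

locale dg_group = abelian_group M for M :: "('a, 'x) dg_ring_scheme" (structure) +
  assumes homog_subgroup: "additive_subgroup (homog M i) M"
    and direct_sum: "x \<in> carrier M \<Longrightarrow> \<exists>!c. is_decomposition M x c"
    and diff_additive: "diff M \<in> hom (add_monoid M) (add_monoid M)"
    and diff_degree: "x \<in> homog M i \<Longrightarrow> diff M x \<in> homog M (i + 1)"
    and diff_diff: "x \<in> carrier M \<Longrightarrow> diff M (diff M x) = \<zero>"

definition dg_hom :: "('a, 'x) dg_ring_scheme \<Rightarrow> ('b, 'y) dg_ring_scheme \<Rightarrow> ('a \<Rightarrow> 'b) set" where
  "dg_hom M N = {h \<in> hom (add_monoid M) (add_monoid N).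
     (\<forall>i. \<forall>x\<in>homog M i. h x \<in> homog N i) \<and> (\<forall>x\<in>carrier M. h (diff M x) = diff N (h x))}"


section \<open>Differential graded algebras\<close>

locale dg_algebra = ring A + dg_group A for A :: "('a, 'x) dg_ring_scheme" (structure) +
  assumes one_homog: "\<one> \<in> homog A 0"
    and mult_homog: "\<lbrakk>a \<in> homog A i; b \<in> homog A j\<rbrakk> \<Longrightarrow> a \<otimes> b \<in> homog A (i + j)"
    and leibniz: "\<lbrakk>a \<in> homog A i; b \<in> homog A j\<rbrakk> \<Longrightarrow>
      diff A (a \<otimes> b) = diff A a \<otimes> b \<oplus> koszul A i (a \<otimes> diff A b)"

definition dg_algebra_hom ::
  "('a, 'x) dg_ring_scheme \<Rightarrow> ('b, 'y) dg_ring_scheme \<Rightarrow> ('a \<Rightarrow> 'b) set" where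
  "dg_algebra_hom A B = ring_hom A B \<inter> dg_hom A B"

definition graded_commutative :: "('a, 'x) dg_ring_scheme \<Rightarrow> bool" where
  "graded_commutative A \<longleftrightarrow> (\<forall>i j. \<forall>a\<in>homog A i. \<forall>b\<in>homog A j.
     a \<otimes>\<^bsub>A\<^esub> b = koszul A (i * j) (b \<otimes>\<^bsub>A\<^esub> a))"

definition graded_centre :: "('a, 'x) dg_ring_scheme \<Rightarrow> 'a set" where
  "graded_centre A = generate (add_monoid A)
     (\<Union>i. {z \<in> homog A i. \<forall>j. \<forall>b\<in>homog A j. z \<otimes>\<^bsub>A\<^esub> b = koszul A (i * j) (b \<otimes>\<^bsub>A\<^esub> z)})"

definition dg_left_ideal :: "'a set \<Rightarrow> ('a, 'x) dg_ring_scheme \<Rightarrow> bool" where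
  "dg_left_ideal I A \<longleftrightarrow> additive_subgroup I A \<and>
     (\<forall>a\<in>carrier A. \<forall>x\<in>I. a \<otimes>\<^bsub>A\<^esub> x \<in> I) \<and>
     (\<forall>x\<in>I. \<forall>i. component A x i \<in> I) \<and> (\<forall>x\<in>I. diff A x \<in> I)"

definition dg_right_ideal :: "'a set \<Rightarrow> ('a, 'x) dg_ring_scheme \<Rightarrow> bool" where
  "dg_right_ideal I A \<longleftrightarrow> additive_subgroup I A \<and>
     (\<forall>a\<in>carrier A. \<forall>x\<in>I. x \<otimes>\<^bsub>A\<^esub> a \<in> I) \<and>
     (\<forall>x\<in>I. \<forall>i. component A x i \<in> I) \<and> (\<forall>x\<in>I. diff A x \<in> I)"

definition dg_division_ring :: "('a, 'x) dg_ring_scheme \<Rightarrow> bool" where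
  "dg_division_ring A \<longleftrightarrow> dg_algebra A \<and>
     (\<forall>I. dg_left_ideal I A \<longrightarrow> I = {\<zero>\<^bsub>A\<^esub>} \<or> I = carrier A) \<and>
     (\<forall>I. dg_right_ideal I A \<longrightarrow> I = {\<zero>\<^bsub>A\<^esub>} \<or> I = carrier A)"

definition dg_algebra_over ::
  "('k, 'x) dg_ring_scheme \<Rightarrow> ('a, 'y) dg_ring_scheme \<Rightarrow> ('k \<Rightarrow> 'a) \<Rightarrow> bool" where
  "dg_algebra_over K A \<iota> \<longleftrightarrow>
     dg_algebra A \<and> \<iota> \<in> dg_algebra_hom K A \<and> \<iota> ` carrier K \<subseteq> graded_centre A"

definition dg_extension ::
  "('k, 'x) dg_ring_scheme \<Rightarrow> ('a, 'y) dg_ring_scheme \<Rightarrow> ('k \<Rightarrow> 'a) \<Rightarrow>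
   ('b, 'z) dg_ring_scheme \<Rightarrow> ('k \<Rightarrow> 'b) \<Rightarrow> ('a \<Rightarrow> 'b) \<Rightarrow> bool" where
  "dg_extension K A \<iota>\<^sub>A B \<iota>\<^sub>B \<phi> \<longleftrightarrow>
     \<phi> \<in> dg_algebra_hom A B \<and> (\<forall>k\<in>carrier K. \<phi> (\<iota>\<^sub>A k) = \<iota>\<^sub>B k)"


section \<open>Differential graded modules and bimodules\<close>

record ('a, 'm) dg_module = "'m dg_ring" +
  lact :: "'a \<Rightarrow> 'm \<Rightarrow> 'm"

locale dg_module = A?: dg_algebra A + M?: dg_group M
  for A :: "('a, 'x) dg_ring_scheme" (structure) and M :: "('a, 'm, 'y) dg_module_scheme" (structure) +
  assumes lact_closed: "\<lbrakk>a \<in> carrier A; m \<in> carrier M\<rbrakk> \<Longrightarrow> lact M a m \<in> carrier M"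
    and lact_add_left: "\<lbrakk>a \<in> carrier A; b \<in> carrier A; m \<in> carrier M\<rbrakk> \<Longrightarrow>
      lact M (a \<oplus>\<^bsub>A\<^esub> b) m = lact M a m \<oplus>\<^bsub>M\<^esub> lact M b m"
    and lact_add_right: "\<lbrakk>a \<in> carrier A; m \<in> carrier M; n \<in> carrier M\<rbrakk> \<Longrightarrow>
      lact M a (m \<oplus>\<^bsub>M\<^esub> n) = lact M a m \<oplus>\<^bsub>M\<^esub> lact M a n"
    and lact_assoc: "\<lbrakk>a \<in> carrier A; b \<in> carrier A; m \<in> carrier M\<rbrakk> \<Longrightarrow>
      lact M (a \<otimes>\<^bsub>A\<^esub> b) m = lact M a (lact M b m)"
    and lact_one: "m \<in> carrier M \<Longrightarrow> lact M \<one>\<^bsub>A\<^esub> m = m"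
    and lact_homog: "\<lbrakk>a \<in> homog A i; m \<in> homog M j\<rbrakk> \<Longrightarrow> lact M a m \<in> homog M (i + j)"
    and lact_leibniz: "\<lbrakk>a \<in> homog A i; m \<in> homog M j\<rbrakk> \<Longrightarrow>
      diff M (lact M a m) = lact M (diff A a) m \<oplus>\<^bsub>M\<^esub> koszul M i (lact M a (diff M m))"

definition dg_module_hom :: "('a, 'x) dg_ring_scheme \<Rightarrow>
   ('a, 'm, 'y) dg_module_scheme \<Rightarrow> ('a, 'n, 'z) dg_module_scheme \<Rightarrow> ('m \<Rightarrow> 'n) set" where
  "dg_module_hom A M N =
     {h \<in> dg_hom M N. \<forall>a\<in>carrier A. \<forall>m\<in>carrier M. h (lact M a m) = lact N a (h m)}"

definition dg_short_exact :: "('a, 'x) dg_ring_scheme \<Rightarrow> ('a, 'l, 'u) dg_module_scheme \<Rightarrow>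
   ('a, 'm, 'v) dg_module_scheme \<Rightarrow> ('a, 'n, 'w) dg_module_scheme \<Rightarrow>
   ('l \<Rightarrow> 'm) \<Rightarrow> ('m \<Rightarrow> 'n) \<Rightarrow> bool" where
  "dg_short_exact A L M N f g \<longleftrightarrow>
     dg_module A L \<and> dg_module A M \<and> dg_module A N \<and>
     f \<in> dg_module_hom A L M \<and> g \<in> dg_module_hom A M N \<and>
     inj_on f (carrier L) \<and> f ` carrier L = a_kernel M N g \<and> g ` carrier M = carrier N"

definition dg_split_short_exact :: "('a, 'x) dg_ring_scheme \<Rightarrow> ('a, 'l, 'u) dg_module_scheme \<Rightarrow>
   ('a, 'm, 'v) dg_module_scheme \<Rightarrow> ('a, 'n, 'w) dg_module_scheme \<Rightarrow>
   ('l \<Rightarrow> 'm) \<Rightarrow> ('m \<Rightarrow> 'n) \<Rightarrow> bool" where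
  "dg_split_short_exact A L M N f g \<longleftrightarrow> dg_short_exact A L M N f g \<and>
     (\<exists>s \<in> dg_module_hom A N M. \<forall>n\<in>carrier N. g (s n) = n)"

definition dg_restrict :: "('a \<Rightarrow> 'b) \<Rightarrow> ('b, 'm) dg_module \<Rightarrow> ('a, 'm) dg_module" where
  "dg_restrict \<phi> M = \<lparr>carrier = carrier M, monoid.mult = monoid.mult M, one = one M, ring.zero = ring.zero M, add = add M,
     homog = homog M, diff = diff M, lact = (\<lambda>a. lact M (\<phi> a))\<rparr>"

record ('a, 'b, 'm) dg_bimodule = "('a, 'm) dg_module" +
  ract :: "'m \<Rightarrow> 'b \<Rightarrow> 'm"

definition dg_bimodule_hom :: "('a, 'x) dg_ring_scheme \<Rightarrow> ('b, 'y) dg_ring_scheme \<Rightarrow>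
   ('a, 'b, 'm, 'u) dg_bimodule_scheme \<Rightarrow> ('a, 'b, 'n, 'v) dg_bimodule_scheme \<Rightarrow>
   ('m \<Rightarrow> 'n) set" where
  "dg_bimodule_hom A B M N =
     {h \<in> dg_module_hom A M N. \<forall>m\<in>carrier M. \<forall>b\<in>carrier B. h (ract M m b) = ract N (h m) b}"

definition dg_regular :: "('b, 'y) dg_ring_scheme \<Rightarrow> ('b, 'b, 'b) dg_bimodule" where
  "dg_regular B = \<lparr>carrier = carrier B, monoid.mult = monoid.mult B, one = one B, ring.zero = ring.zero B, add = add B,
     homog = homog B, diff = diff B, lact = monoid.mult B, ract = monoid.mult B\<rparr>"


section \<open>The bimodule \<open>B \<otimes>\<^sub>A B\<close> and separability\<close>

text \<open>
  The tensor product is the free abelian group on pairs of elements of \<open>B\<close> modulo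
  biadditivity and \<open>A\<close>-balancedness, so its elements are cosets of \<open>tensor_rel\<close>.
\<close>

definition tensor_free :: "('b, 'y) dg_ring_scheme \<Rightarrow> ('b \<times> 'b \<Rightarrow>\<^sub>0 int) monoid" where
  "tensor_free B = free_Abelian_group (carrier B \<times> carrier B)"

definition tensor_rel :: "('a, 'x) dg_ring_scheme \<Rightarrow> ('b, 'y) dg_ring_scheme \<Rightarrow> ('a \<Rightarrow> 'b) \<Rightarrow>
    ('b \<times> 'b \<Rightarrow>\<^sub>0 int) set" where
  "tensor_rel A B \<phi> = generate (tensor_free B)
    ({frag_of (x \<oplus>\<^bsub>B\<^esub> x', y) - frag_of (x, y) - frag_of (x', y) | x x' y.
        x \<in> carrier B \<and> x' \<in> carrier B \<and> y \<in> carrier B} \<union>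
     {frag_of (x, y \<oplus>\<^bsub>B\<^esub> y') - frag_of (x, y) - frag_of (x, y') | x y y'.
        x \<in> carrier B \<and> y \<in> carrier B \<and> y' \<in> carrier B} \<union>
     {frag_of (x \<otimes>\<^bsub>B\<^esub> \<phi> a, y) - frag_of (x, \<phi> a \<otimes>\<^bsub>B\<^esub> y) | x a y.
        x \<in> carrier B \<and> a \<in> carrier A \<and> y \<in> carrier B})"

definition tensor_group :: "('a, 'x) dg_ring_scheme \<Rightarrow> ('b, 'y) dg_ring_scheme \<Rightarrow> ('a \<Rightarrow> 'b) \<Rightarrow>
    ('b \<times> 'b \<Rightarrow>\<^sub>0 int) set monoid" where
  "tensor_group A B \<phi> = tensor_free B Mod tensor_rel A B \<phi>"

definition tensor_pure :: "('a, 'x) dg_ring_scheme \<Rightarrow> ('b, 'y) dg_ring_scheme \<Rightarrow> ('a \<Rightarrow> 'b) \<Rightarrow>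
    'b \<Rightarrow> 'b \<Rightarrow> ('b \<times> 'b \<Rightarrow>\<^sub>0 int) set" where
  "tensor_pure A B \<phi> x y = tensor_rel A B \<phi> #>\<^bsub>tensor_free B\<^esub> frag_of (x, y)"

text \<open>
  The endomorphism induced on the quotient by the additive extension of \<open>t\<close> to the free group;
  the union collapses to a single coset as soon as this extension preserves \<open>tensor_rel\<close>.
\<close>

definition tensor_induced :: "('a, 'x) dg_ring_scheme \<Rightarrow> ('b, 'y) dg_ring_scheme \<Rightarrow> ('a \<Rightarrow> 'b) \<Rightarrow>
    ('b \<times> 'b \<Rightarrow> 'b \<times> 'b \<Rightarrow>\<^sub>0 int) \<Rightarrow> ('b \<times> 'b \<Rightarrow>\<^sub>0 int) set \<Rightarrow> ('b \<times> 'b \<Rightarrow>\<^sub>0 int) set" where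
  "tensor_induced A B \<phi> t Z = (\<Union>u\<in>Z. tensor_rel A B \<phi> #>\<^bsub>tensor_free B\<^esub> frag_extend t u)"

definition grade_involution :: "('b, 'y) dg_ring_scheme \<Rightarrow> 'b \<Rightarrow> 'b" where
  "grade_involution B x =
     finsum B (\<lambda>i. koszul B i (component B x i)) {i. component B x i \<noteq> \<zero>\<^bsub>B\<^esub>}"

text \<open>
  For homogeneous \<open>x\<close> the second summand of the differential is $(-1)^{|x|} x \otimes d y$, see
  \<open>tensor_diff_pure\<close> below; the involution is what makes the formula additive in \<open>x\<close>.
\<close>

definition dg_tensor :: "('a, 'x) dg_ring_scheme \<Rightarrow> ('b, 'y) dg_ring_scheme \<Rightarrow> ('a \<Rightarrow> 'b) \<Rightarrow>
    ('b, 'b, ('b \<times> 'b \<Rightarrow>\<^sub>0 int) set) dg_bimodule" where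
  "dg_tensor A B \<phi> =
    \<lparr>carrier = carrier (tensor_group A B \<phi>),
     monoid.mult = undefined,
     one = undefined,
     ring.zero = one (tensor_group A B \<phi>),
     add = monoid.mult (tensor_group A B \<phi>),
     homog = (\<lambda>n. generate (tensor_group A B \<phi>)
       {tensor_pure A B \<phi> x y | x y. \<exists>i j. x \<in> homog B i \<and> y \<in> homog B j \<and> i + j = n}),
     diff = tensor_induced A B \<phi>
       (\<lambda>(x, y). frag_of (diff B x, y) + frag_of (grade_involution B x, diff B y)),
     lact = (\<lambda>b. tensor_induced A B \<phi> (\<lambda>(x, y). frag_of (b \<otimes>\<^bsub>B\<^esub> x, y))),
     ract = (\<lambda>Z b. tensor_induced A B \<phi> (\<lambda>(x, y). frag_of (x, y \<otimes>\<^bsub>B\<^esub> b)) Z)\<rparr>"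

definition tensor_mult :: "('b, 'y) dg_ring_scheme \<Rightarrow> ('b \<times> 'b \<Rightarrow>\<^sub>0 int) set \<Rightarrow> 'b" where
  "tensor_mult B Z = the_elem
     ((\<lambda>u. finsum B (\<lambda>(x, y). [Poly_Mapping.lookup u (x, y)] \<cdot>\<^bsub>B\<^esub> (x \<otimes>\<^bsub>B\<^esub> y))
            (Poly_Mapping.keys u)) ` Z)"

definition dg_separable ::
  "('a, 'x) dg_ring_scheme \<Rightarrow> ('b, 'y) dg_ring_scheme \<Rightarrow> ('a \<Rightarrow> 'b) \<Rightarrow> bool" where
  "dg_separable A B \<phi> \<longleftrightarrow>
     (\<exists>\<rho> \<in> dg_bimodule_hom B B (dg_regular B) (dg_tensor A B \<phi>).
        \<forall>b\<in>carrier B. tensor_mult B (\<rho> b) = b)"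


section \<open>The structure maps of \<open>B \<otimes>\<^sub>A B\<close> on pure tensors\<close>

lemma (in dg_group) component_decomposition: "x \<in> carrier M \<Longrightarrow> is_decomposition M x (component M x)"
  unfolding component_def using theI'[OF direct_sum] by blast

lemma (in dg_group) component_eq: "x \<in> carrier M \<Longrightarrow> is_decomposition M x c \<Longrightarrow> component M x = c"
  using component_decomposition direct_sum by blast

lemma (in dg_group) homog_carrier: "x \<in> homog M i \<Longrightarrow> x \<in> carrier M"
  using additive_subgroup.a_subset[OF homog_subgroup] by blast

lemma (in dg_group) homog_zero: "\<zero> \<in> homog M i"
  using additive_subgroup.zero_closed[OF homog_subgroup] .

lemma (in dg_group) component_homog:
  assumes "x \<in> homog M i" shows "component M x = (\<lambda>j. if j = i then x else \<zero>)"
proof (rule component_eq)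
  have e: "{j. (if j = i then x else \<zero>) \<noteq> \<zero>} = (if x = \<zero> then {} else {i})" by auto
  show "is_decomposition M x (\<lambda>j. if j = i then x else \<zero>)"
    unfolding is_decomposition_def e using assms homog_zero homog_carrier[OF assms] by auto
qed (use assms homog_carrier in auto)

lemma (in dg_group) grade_involution_homog:
  assumes "x \<in> homog M i" shows "grade_involution M x = koszul M i x"
proof -
  have m0: "\<ominus> \<zero> = \<zero>" by (metis l_zero r_neg a_inv_closed zero_closed)
  have e: "{j. (if j = i then x else \<zero>) \<noteq> \<zero>} = (if x = \<zero> then {} else {i})" by auto
  show ?thesis unfolding grade_involution_def component_homog[OF assms] e
    using homog_carrier[OF assms] by (cases "x = \<zero>") (simp_all add: koszul_def m0)
qed

lemma (in dg_group) koszul_closed: "x \<in> carrier M \<Longrightarrow> koszul M i x \<in> carrier M"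
  by (simp add: koszul_def)
lemma (in dg_group) koszul_add: "x \<in> carrier M \<Longrightarrow> y \<in> carrier M \<Longrightarrow> koszul M i (x \<oplus> y) = koszul M i x \<oplus> koszul M i y"
  by (simp add: koszul_def minus_add)

lemma (in dg_group) component_closed: "x \<in> carrier M \<Longrightarrow> component M x i \<in> homog M i"
  using component_decomposition by (simp add: is_decomposition_def)
lemma (in dg_group) component_fin: "x \<in> carrier M \<Longrightarrow> finite {i. component M x i \<noteq> \<zero>}"
  using component_decomposition by (simp add: is_decomposition_def)
lemma (in dg_group) component_sum: assumes "x \<in> carrier M" "finite S" "{i. component M x i \<noteq> \<zero>} \<subseteq> S"
  shows "x = finsum M (component M x) S"
proof -
  have "x = finsum M (component M x) {i. component M x i \<noteq> \<zero>}" using component_decomposition[OF assms(1)] by (simp add: is_decomposition_def)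
  also have "... = finsum M (component M x) S"
    by (rule add.finprod_mono_neutral_cong_left) (use assms homog_carrier[OF component_closed] in auto)
  finally show ?thesis .
qed
lemma (in dg_group) grade_involution_sum: assumes "x \<in> carrier M" "finite S" "{i. component M x i \<noteq> \<zero>} \<subseteq> S"
  shows "grade_involution M x = finsum M (\<lambda>i. koszul M i (component M x i)) S"
  unfolding grade_involution_def
    by (rule add.finprod_mono_neutral_cong_left) (use assms homog_carrier[OF component_closed] koszul_closed in \<open>auto simp: koszul_def\<close>)

lemma (in dg_group) grade_involution_closed: "x \<in> carrier M \<Longrightarrow> grade_involution M x \<in> carrier M"
  unfolding grade_involution_def using homog_carrier[OF component_closed] koszul_closed by auto

lemma (in dg_group) component_add: assumes "x \<in> carrier M" "y \<in> carrier M"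
  shows "component M (x \<oplus> y) = (\<lambda>i. component M x i \<oplus> component M y i)"
proof (rule component_eq)
  let ?c = "\<lambda>i. component M x i \<oplus> component M y i"
  let ?S = "{i. component M x i \<noteq> \<zero>} \<union> {i. component M y i \<noteq> \<zero>}"
  have fin: "finite ?S" using component_fin assms by auto
  have sub: "{i. ?c i \<noteq> \<zero>} \<subseteq> ?S" by auto
  have cc: "component M x i \<in> carrier M" "component M y i \<in> carrier M" for i using homog_carrier[OF component_closed] assms by auto
  have "finsum M ?c {i. ?c i \<noteq> \<zero>} = finsum M ?c ?S"
    by (rule add.finprod_mono_neutral_cong_left) (use fin sub cc in auto)
  also have "... = finsum M (component M x) ?S \<oplus> finsum M (component M y) ?S"
    by (rule finsum_addf) (use cc in auto)
  also have "... = x \<oplus> y" using component_sum[OF assms(1) fin] component_sum[OF assms(2) fin] by auto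
  finally show "is_decomposition M (x \<oplus> y) ?c"
    unfolding is_decomposition_def using finite_subset[OF sub fin]
      additive_subgroup.a_closed[OF homog_subgroup component_closed component_closed] assms by auto
qed (use assms in auto)

lemma (in dg_group) grade_involution_add: assumes "x \<in> carrier M" "y \<in> carrier M"
  shows "grade_involution M (x \<oplus> y) = grade_involution M x \<oplus> grade_involution M y"
proof -
  let ?S = "{i. component M x i \<noteq> \<zero>} \<union> {i. component M y i \<noteq> \<zero>}"
  have fin: "finite ?S" using component_fin assms by auto
  have cc: "component M x i \<in> carrier M" "component M y i \<in> carrier M" for i using homog_carrier[OF component_closed] assms by auto
  have "grade_involution M (x \<oplus> y) = finsum M (\<lambda>i. koszul M i (component M (x \<oplus> y) i)) ?S"
    by (rule grade_involution_sum) (use assms fin in \<open>auto simp: component_add\<close>)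
  also have "... = finsum M (\<lambda>i. koszul M i (component M x i) \<oplus> koszul M i (component M y i)) ?S"
    by (simp add: component_add assms koszul_add cc)
  also have "... = finsum M (\<lambda>i. koszul M i (component M x i)) ?S \<oplus> finsum M (\<lambda>i. koszul M i (component M y i)) ?S"
    by (rule finsum_addf) (use cc koszul_closed in auto)
  finally show ?thesis using grade_involution_sum[OF assms(1) fin] grade_involution_sum[OF assms(2) fin] by auto
qed

lemma (in dg_group) homog_induct [consumes 1, case_names homog add]:
  assumes "x \<in> carrier M" "\<And>i x. x \<in> homog M i \<Longrightarrow> P x"
    "\<And>x y. x \<in> carrier M \<Longrightarrow> y \<in> carrier M \<Longrightarrow> P x \<Longrightarrow> P y \<Longrightarrow> P (x \<oplus> y)"
  shows "P x"
proof -
  have cc: "component M x i \<in> carrier M" for i using homog_carrier[OF component_closed] assms by auto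
  have "P (finsum M (component M x) S)" if "finite S" for S
    using that
  proof (induction S)
    case empty then show ?case using assms(2)[OF homog_zero] by simp
  next
    case (insert i S)
    have "P (component M x i \<oplus> finsum M (component M x) S)"
      by (intro assms(3) insert.IH assms(2)[OF component_closed]) (use cc assms(1) in auto)
    then show ?case using insert cc by simp
  qed
  from this[OF component_fin[OF assms(1)]] show ?thesis using component_sum[OF assms(1) component_fin[OF assms(1)] subset_refl] by simp
qed

context dg_group begin
lemma diff_closed: "x \<in> carrier M \<Longrightarrow> diff M x \<in> carrier M" using diff_additive by (auto simp: hom_def)
lemma diff_add: "x \<in> carrier M \<Longrightarrow> y \<in> carrier M \<Longrightarrow> diff M (x \<oplus> y) = diff M x \<oplus> diff M y" using diff_additive by (auto simp: hom_def)
end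

context dg_algebra begin
lemma leibniz': assumes "a \<in> carrier A" "b \<in> carrier A"
  shows "diff A (a \<otimes> b) = diff A a \<otimes> b \<oplus> grade_involution A a \<otimes> diff A b"
  using assms
proof (induction a rule: homog_induct)
  case (homog i x)
  note hx = homog(1)
  from \<open>b \<in> carrier A\<close> show ?case
  proof (induction b rule: homog_induct)
    case (homog j y)
    show ?case using leibniz[OF hx homog] homog_carrier[OF homog] homog_carrier[OF hx]
      by (simp add: grade_involution_homog[OF hx] koszul_def l_minus diff_closed)
  next
    case (add y z)
    have x: "x \<in> carrier A" using hx homog_carrier by auto
    show ?case using add x by (simp add: r_distr diff_add diff_closed grade_involution_closed a_ac)
  qed
next
  case (add x y)
  then show ?case by (simp add: l_distr diff_add diff_closed grade_involution_closed grade_involution_add a_ac)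
qed

lemma grade_involution_mult: assumes "a \<in> carrier A" "b \<in> carrier A"
  shows "grade_involution A (a \<otimes> b) = grade_involution A a \<otimes> grade_involution A b"
  using assms
proof (induction a rule: homog_induct)
  case (homog i x)
  note hx = homog(1)
  from \<open>b \<in> carrier A\<close> show ?case
  proof (induction b rule: homog_induct)
    case (homog j y)
    have m: "x \<otimes> y \<in> homog A (i + j)" using mult_homog[OF hx homog] .
    have c: "x \<in> carrier A" "y \<in> carrier A" using homog_carrier homog hx by auto
    show ?case unfolding grade_involution_homog[OF hx] grade_involution_homog[OF homog] grade_involution_homog[OF m]
      by (cases "even i"; cases "even j"; simp add: koszul_def l_minus r_minus c)
  next
    case (add y z)
    have x: "x \<in> carrier A" using hx homog_carrier by auto
    show ?case using add x by (simp add: r_distr grade_involution_closed grade_involution_add)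
  qed
next
  case (add x y)
  then show ?case by (simp add: l_distr grade_involution_closed grade_involution_add)
qed
end

locale dg_algebra_extension = A: dg_algebra A + B: dg_algebra B for A :: "('a,'x) dg_ring_scheme" and B :: "('b,'y) dg_ring_scheme" +
  fixes \<phi> assumes phi: "\<phi> \<in> dg_algebra_hom A B"
begin
abbreviation "F \<equiv> tensor_free B"
abbreviation "R \<equiv> tensor_rel A B \<phi>"
lemma phi_closed: "a \<in> carrier A \<Longrightarrow> \<phi> a \<in> carrier B"
  using phi by (auto simp: dg_algebra_hom_def ring_hom_def)
lemma phi_diff: "a \<in> carrier A \<Longrightarrow> diff B (\<phi> a) = \<phi> (diff A a)"
  using phi by (auto simp: dg_algebra_hom_def dg_hom_def)
lemma phi_add: "a \<in> carrier A \<Longrightarrow> b \<in> carrier A \<Longrightarrow> \<phi> (a \<oplus>\<^bsub>A\<^esub> b) = \<phi> a \<oplus>\<^bsub>B\<^esub> \<phi> b"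
  using phi by (auto simp: dg_algebra_hom_def ring_hom_def)
lemma phi_homog: "a \<in> homog A i \<Longrightarrow> \<phi> a \<in> homog B i"
  using phi by (auto simp: dg_algebra_hom_def dg_hom_def)
lemma phi_zero: "\<phi> \<zero>\<^bsub>A\<^esub> = \<zero>\<^bsub>B\<^esub>"
  using phi_add[of "\<zero>\<^bsub>A\<^esub>" "\<zero>\<^bsub>A\<^esub>"] phi_closed[of "\<zero>\<^bsub>A\<^esub>"] B.add.l_cancel_one by auto
lemma phi_minus: assumes a: "a \<in> carrier A" shows "\<phi> (\<ominus>\<^bsub>A\<^esub> a) = \<ominus>\<^bsub>B\<^esub> \<phi> a"
proof -
  have "\<phi> (\<ominus>\<^bsub>A\<^esub> a) \<oplus>\<^bsub>B\<^esub> \<phi> a = \<zero>\<^bsub>B\<^esub>"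
    using phi_add[of "\<ominus>\<^bsub>A\<^esub> a" a] a phi_zero by (simp add: A.l_neg)
  then show ?thesis using B.minus_equality[of "\<phi> (\<ominus>\<^bsub>A\<^esub> a)" "\<phi> a"] phi_closed a by auto
qed

lemma grade_involution_phi: "a \<in> carrier A \<Longrightarrow> grade_involution B (\<phi> a) = \<phi> (grade_involution A a)"
proof (induction a rule: A.homog_induct)
  case (homog i x)
  then show ?case by (simp add: A.grade_involution_homog[OF homog] B.grade_involution_homog[OF phi_homog] koszul_def phi_minus A.homog_carrier)
next
  case (add x y)
  then show ?case by (simp add: phi_add A.grade_involution_closed A.grade_involution_add B.grade_involution_add phi_closed)
qed

lemma Fgroup: "group F" and Fcomm: "comm_group F" by (simp_all add: tensor_free_def abelian_free_Abelian_group)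
lemma F_simps: "u \<otimes>\<^bsub>F\<^esub> v = u + v" "\<one>\<^bsub>F\<^esub> = 0" by (simp_all add: tensor_free_def)
lemma F_diff: "u \<in> carrier F \<Longrightarrow> v \<in> carrier F \<Longrightarrow> u - v \<in> carrier F"
 unfolding tensor_free_def carrier_free_Abelian_group_iff using keys_diff[of u v] by blast
lemma F_add: "u \<in> carrier F \<Longrightarrow> v \<in> carrier F \<Longrightarrow> u + v \<in> carrier F"
 unfolding tensor_free_def carrier_free_Abelian_group_iff using Poly_Mapping.keys_add[of u v] by blast
lemma F_of: "x \<in> carrier B \<Longrightarrow> y \<in> carrier B \<Longrightarrow> frag_of (x,y) \<in> carrier F" by (simp add: tensor_free_def)
lemma F_inv: "u \<in> carrier F \<Longrightarrow> inv\<^bsub>F\<^esub> u = - u" by (simp add: tensor_free_def)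

definition "tensor_generators = ({frag_of (x \<oplus>\<^bsub>B\<^esub> x', y) - frag_of (x, y) - frag_of (x', y) | x x' y.
        x \<in> carrier B \<and> x' \<in> carrier B \<and> y \<in> carrier B} \<union>
     {frag_of (x, y \<oplus>\<^bsub>B\<^esub> y') - frag_of (x, y) - frag_of (x, y') | x y y'.
        x \<in> carrier B \<and> y \<in> carrier B \<and> y' \<in> carrier B} \<union>
     {frag_of (x \<otimes>\<^bsub>B\<^esub> \<phi> a, y) - frag_of (x, \<phi> a \<otimes>\<^bsub>B\<^esub> y) | x a y.
        x \<in> carrier B \<and> a \<in> carrier A \<and> y \<in> carrier B})"
lemma tensor_rel_eq: "R = generate F tensor_generators" by (simp add: tensor_rel_def tensor_generators_def)
lemma generators_closed: "tensor_generators \<subseteq> carrier F"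
  by (auto simp: tensor_generators_def phi_closed intro!: F_diff F_of)
lemma R_sub: "subgroup R F" unfolding tensor_rel_eq by (rule group.generate_is_subgroup[OF Fgroup generators_closed])
lemma R_add: "u \<in> R \<Longrightarrow> v \<in> R \<Longrightarrow> u + v \<in> R" using subgroup.m_closed[OF R_sub] by (simp add: F_simps)
lemma R_F: "u \<in> R \<Longrightarrow> u \<in> carrier F" using subgroup.mem_carrier[OF R_sub] by simp
lemma R_neg: "u \<in> R \<Longrightarrow> - u \<in> R" using subgroup.m_inv_closed[OF R_sub] R_F by (simp add: F_inv)
lemma R_diff: "u \<in> R \<Longrightarrow> v \<in> R \<Longrightarrow> u - v \<in> R" using R_add[OF _ R_neg] by simp
lemma R_norm: "R \<lhd> F" using comm_group.subgroup_imp_normal[OF Fcomm R_sub] .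

lemma rel_add_left: "x \<in> carrier B \<Longrightarrow> x' \<in> carrier B \<Longrightarrow> y \<in> carrier B \<Longrightarrow> frag_of (x \<oplus>\<^bsub>B\<^esub> x', y) - frag_of (x, y) - frag_of (x', y) \<in> R"
  unfolding tensor_rel_eq by (rule generate.incl) (auto simp: tensor_generators_def)
lemma rel_add_right: "x \<in> carrier B \<Longrightarrow> y' \<in> carrier B \<Longrightarrow> y \<in> carrier B \<Longrightarrow> frag_of (x, y \<oplus>\<^bsub>B\<^esub> y') - frag_of (x, y) - frag_of (x, y') \<in> R"
  unfolding tensor_rel_eq by (rule generate.incl) (auto simp: tensor_generators_def)
lemma rel_balanced: "x \<in> carrier B \<Longrightarrow> a \<in> carrier A \<Longrightarrow> y \<in> carrier B \<Longrightarrow> frag_of (x \<otimes>\<^bsub>B\<^esub> \<phi> a, y) - frag_of (x, \<phi> a \<otimes>\<^bsub>B\<^esub> y) \<in> R"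
  unfolding tensor_rel_eq by (rule generate.incl) (auto simp: tensor_generators_def)

lemma tensor_coset_eq: assumes "u \<in> carrier F" "v \<in> carrier F" "u - v \<in> R" shows "R #>\<^bsub>F\<^esub> u = R #>\<^bsub>F\<^esub> v"
proof -
  have "u \<in> R #>\<^bsub>F\<^esub> v" unfolding r_coset_def F_simps using assms(3)
    by (intro UN_I[of "u - v"]) simp_all
  from group.repr_independence[OF Fgroup this assms(2) R_sub] show ?thesis by simp
qed

lemma tensor_induced_coset:
  assumes "\<And>x y. x \<in> carrier B \<Longrightarrow> y \<in> carrier B \<Longrightarrow> t (x,y) \<in> carrier F"
    "\<And>u. u \<in> tensor_generators \<Longrightarrow> frag_extend t u \<in> R" and u: "u \<in> carrier F"
  shows "tensor_induced A B \<phi> t (R #>\<^bsub>F\<^esub> u) = R #>\<^bsub>F\<^esub> frag_extend t u"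
proof -
  have R: "frag_extend t v \<in> R" if "v \<in> R" for v
    using that unfolding tensor_rel_eq
  proof (induction v rule: generate.induct)
    case one then show ?case using subgroup.one_closed[OF R_sub] by (simp add: F_simps tensor_rel_eq)
  next
    case (incl h) then show ?case using assms(2) by (simp add: tensor_rel_eq)
  next
    case (inv h) then have "h \<in> carrier F" using generators_closed by auto
    then show ?case using assms(2)[OF inv] R_neg by (simp add: F_inv frag_extend_minus tensor_rel_eq)
  next
    case (eng h1 h2) then show ?case using R_add by (simp add: F_simps frag_extend_add tensor_rel_eq)
  qed
  have tF: "frag_extend t v \<in> carrier F" if "v \<in> carrier F" for v
  proof -
    have "Poly_Mapping.keys v \<subseteq> carrier B \<times> carrier B" using that by (simp add: tensor_free_def)
    then show ?thesis
    proof (induction v rule: frag_induction)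
      case zero then show ?case by (simp add: tensor_free_def)
    next
      case (one x) then show ?case using assms(1) by auto
    next
      case (diff a b) then show ?case by (simp add: frag_extend_diff F_diff)
    qed
  qed
  have *: "R #>\<^bsub>F\<^esub> frag_extend t v = R #>\<^bsub>F\<^esub> frag_extend t u" if v: "v \<in> R #>\<^bsub>F\<^esub> u" for v
  proof -
    obtain r where r: "r \<in> R" "v = r + u" using v by (auto simp: r_coset_def F_simps)
    have vF: "v \<in> carrier F" using r R_F u F_add by auto
    show ?thesis by (rule tensor_coset_eq) (use tF[OF vF] tF[OF u] r R in \<open>auto simp: frag_extend_add\<close>)
  qed
  have ne: "u \<in> R #>\<^bsub>F\<^esub> u" using group.rcos_self[OF Fgroup u R_sub] .
  show ?thesis unfolding tensor_induced_def using * ne by blast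
qed

lemma diff_generators:
  assumes "u \<in> tensor_generators"
  shows "frag_extend (\<lambda>(x, y). frag_of (diff B x, y) + frag_of (grade_involution B x, diff B y)) u \<in> R" (is "?D u \<in> R")
proof -
  note cl = B.diff_closed B.grade_involution_closed phi_closed A.diff_closed A.grade_involution_closed
  consider x x' y where "x \<in> carrier B" "x' \<in> carrier B" "y \<in> carrier B" "u = frag_of (x \<oplus>\<^bsub>B\<^esub> x', y) - frag_of (x, y) - frag_of (x', y)"
    | x y y' where "x \<in> carrier B" "y' \<in> carrier B" "y \<in> carrier B" "u = frag_of (x, y \<oplus>\<^bsub>B\<^esub> y') - frag_of (x, y) - frag_of (x, y')"
    | x a y where "x \<in> carrier B" "a \<in> carrier A" "y \<in> carrier B" "u = frag_of (x \<otimes>\<^bsub>B\<^esub> \<phi> a, y) - frag_of (x, \<phi> a \<otimes>\<^bsub>B\<^esub> y)"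
    using assms unfolding tensor_generators_def by auto
  then show ?thesis
  proof cases
    case 1
    have "?D u = (frag_of (diff B x \<oplus>\<^bsub>B\<^esub> diff B x', y) - frag_of (diff B x, y) - frag_of (diff B x', y)) +
       (frag_of (grade_involution B x \<oplus>\<^bsub>B\<^esub> grade_involution B x', diff B y) - frag_of (grade_involution B x, diff B y) - frag_of (grade_involution B x', diff B y))"
      using 1 by (simp add: frag_extend_diff B.diff_add B.grade_involution_add)
    also have "... \<in> R" by (intro R_add rel_add_left) (use 1 cl in auto)
    finally show ?thesis .
  next
    case 2
    have "?D u = (frag_of (diff B x, y \<oplus>\<^bsub>B\<^esub> y') - frag_of (diff B x, y) - frag_of (diff B x, y')) +
       (frag_of (grade_involution B x, diff B y \<oplus>\<^bsub>B\<^esub> diff B y') - frag_of (grade_involution B x, diff B y) - frag_of (grade_involution B x, diff B y'))"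
      using 2 by (simp add: frag_extend_diff B.diff_add B.grade_involution_add)
    also have "... \<in> R" by (intro R_add rel_add_right) (use 2 cl in auto)
    finally show ?thesis .
  next
    case 3
    let ?s = "grade_involution B" and ?d = "diff B"
    have "?D u = (frag_of (?d x \<otimes>\<^bsub>B\<^esub> \<phi> a \<oplus>\<^bsub>B\<^esub> ?s x \<otimes>\<^bsub>B\<^esub> \<phi> (diff A a), y) - frag_of (?d x \<otimes>\<^bsub>B\<^esub> \<phi> a, y) - frag_of (?s x \<otimes>\<^bsub>B\<^esub> \<phi> (diff A a), y))
     + (frag_of (?d x \<otimes>\<^bsub>B\<^esub> \<phi> a, y) - frag_of (?d x, \<phi> a \<otimes>\<^bsub>B\<^esub> y))
     + (frag_of (?s x \<otimes>\<^bsub>B\<^esub> \<phi> (diff A a), y) - frag_of (?s x, \<phi> (diff A a) \<otimes>\<^bsub>B\<^esub> y))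
     + (frag_of (?s x \<otimes>\<^bsub>B\<^esub> \<phi> (grade_involution A a), ?d y) - frag_of (?s x, \<phi> (grade_involution A a) \<otimes>\<^bsub>B\<^esub> ?d y))
     - (frag_of (?s x, \<phi> (diff A a) \<otimes>\<^bsub>B\<^esub> y \<oplus>\<^bsub>B\<^esub> \<phi> (grade_involution A a) \<otimes>\<^bsub>B\<^esub> ?d y) - frag_of (?s x, \<phi> (diff A a) \<otimes>\<^bsub>B\<^esub> y) - frag_of (?s x, \<phi> (grade_involution A a) \<otimes>\<^bsub>B\<^esub> ?d y))"
      using 3 by (simp add: frag_extend_diff B.leibniz' B.grade_involution_mult phi_closed phi_diff grade_involution_phi)
    also have "... \<in> R" by (rule R_diff[OF R_add[OF R_add[OF R_add[OF rel_add_left rel_balanced] rel_balanced] rel_balanced] rel_add_right]) (use 3 cl in auto)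
    finally show ?thesis .
  qed
qed

lemma tensor_diff_pure: assumes "x \<in> homog B i" "y \<in> carrier B"
  shows "diff (dg_tensor A B \<phi>) (tensor_pure A B \<phi> x y) =
     tensor_pure A B \<phi> (diff B x) y \<oplus>\<^bsub>dg_tensor A B \<phi>\<^esub> tensor_pure A B \<phi> (koszul B i x) (diff B y)"
proof -
  have x: "x \<in> carrier B" using assms B.homog_carrier by auto
  note cl = B.diff_closed B.grade_involution_closed F_add F_of
  have "diff (dg_tensor A B \<phi>) (tensor_pure A B \<phi> x y) = R #>\<^bsub>F\<^esub> frag_extend (\<lambda>(x, y). frag_of (diff B x, y) + frag_of (grade_involution B x, diff B y)) (frag_of (x,y))"
    unfolding tensor_pure_def dg_tensor_def dg_ring.simps dg_module.simps
    by (simp, subst tensor_induced_coset) (use diff_generators x assms cl in auto)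
  also have "... = R #>\<^bsub>F\<^esub> (frag_of (diff B x, y) \<otimes>\<^bsub>F\<^esub> frag_of (koszul B i x, diff B y))"
    using assms by (simp add: F_simps B.grade_involution_homog)
  also have "... = (R #>\<^bsub>F\<^esub> frag_of (diff B x, y)) <#>\<^bsub>F\<^esub> (R #>\<^bsub>F\<^esub> frag_of (koszul B i x, diff B y))"
    by (rule normal.rcos_sum[OF R_norm, symmetric]) (use x assms cl B.koszul_closed in auto)
  finally show ?thesis by (simp add: tensor_pure_def dg_tensor_def tensor_group_def)
qed

lemma tensor_lact_pure: assumes "b \<in> carrier B" "x \<in> carrier B" "y \<in> carrier B"
  shows "lact (dg_tensor A B \<phi>) b (tensor_pure A B \<phi> x y) = tensor_pure A B \<phi> (b \<otimes>\<^bsub>B\<^esub> x) y"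
proof -
  have "frag_extend (\<lambda>(x, y). frag_of (b \<otimes>\<^bsub>B\<^esub> x, y)) u \<in> R" if "u \<in> tensor_generators" for u
    using that assms(1) unfolding tensor_generators_def
    by (auto simp: frag_extend_diff B.r_distr B.m_assoc[symmetric] phi_closed rel_add_left rel_add_right rel_balanced)
  then show ?thesis
    unfolding tensor_pure_def dg_tensor_def by (simp, subst tensor_induced_coset) (use assms F_of in auto)
qed

lemma tensor_ract_pure: assumes "b \<in> carrier B" "x \<in> carrier B" "y \<in> carrier B"
  shows "ract (dg_tensor A B \<phi>) (tensor_pure A B \<phi> x y) b = tensor_pure A B \<phi> x (y \<otimes>\<^bsub>B\<^esub> b)"
proof -
  have "frag_extend (\<lambda>(x, y). frag_of (x, y \<otimes>\<^bsub>B\<^esub> b)) u \<in> R" if "u \<in> tensor_generators" for u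
    using that assms(1) unfolding tensor_generators_def
    by (auto simp: frag_extend_diff B.l_distr B.m_assoc phi_closed rel_add_left rel_add_right rel_balanced)
  then show ?thesis
    unfolding tensor_pure_def dg_tensor_def by (simp, subst tensor_induced_coset) (use assms F_of in auto)
qed

end

end

theory Submission
  imports Defs
begin

text \<open>
  A \<open>B\<close>-linear section is also \<open>A\<close>-linear, so splitting over \<open>B\<close> implies splitting over \<open>A\<close>.

  For the converse, let $s : N \to M$ be an \<open>A\<close>-linear section of \<open>g\<close> and let $\rho$ split the
  multiplication of \<open>B\<close>.  As in Maschke's theorem, \<open>s\<close> is averaged along the separability element
  $e = \rho(1) = \sum x_k \otimes y_k$, giving $s'(n) = \sum x_k\, s(y_k n)$.  This is well defined
  because $x \otimes y \mapsto x\, s(y n)$ is additive in both variables and balanced over \<open>A\<close>.  Then: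

  \<^item> $g(s'(n)) = (\sum x_k y_k) n = n$, as \<open>g\<close> is \<open>B\<close>-linear and the multiplication sends \<open>e\<close> to \<open>1\<close>
    (\<open>average_section\<close>);
  \<^item> $s'$ is \<open>B\<close>-linear, as $b e = e b$ (\<open>average_lact\<close>, \<open>average_ract\<close>);
  \<^item> $s'$ preserves degrees, as \<open>e\<close> has degree zero (\<open>average_homog\<close>);
  \<^item> $s'$ commutes with differentials, as \<open>e\<close> is a cycle of degree zero (\<open>average_diff\<close>).

  Each identity for the average along a tensor \<open>Z\<close> says that two homomorphisms in \<open>Z\<close> coincide.
  It therefore only has to be checked on pure tensors (\<open>tensor_hom_eqI\<close>), or on homogeneous pure
  tensors of one total degree.
\<close>


section \<open>Group homomorphisms determined by generators\<close>

lemma hom_eq_on_generate: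
  assumes "group G" "group H" "h \<in> hom G H" "k \<in> hom G H" "S \<subseteq> carrier G"
    and eq: "\<And>x. x \<in> S \<Longrightarrow> h x = k x" and "x \<in> generate G S"
  shows "h x = k x"
proof -
  interpret h: group_hom G H h using assms by (simp add: group_hom_def group_hom_axioms_def)
  interpret k: group_hom G H k using assms by (simp add: group_hom_def group_hom_axioms_def)
  from \<open>x \<in> generate G S\<close> show ?thesis
  proof (induction rule: generate.induct)
    case (inv y)
    then show ?case using eq \<open>S \<subseteq> carrier G\<close> by auto
  next
    case (eng y z)
    then show ?case using group.generate_in_carrier[OF assms(1,5)] by auto
  qed (use eq in auto)
qed

text \<open>Turns a homomorphism known only by its values on generators into a sum of the shape of \<open>tensor_mult\<close>.\<close>

lemma hom_sum_frag:
  assumes "comm_group G" "h \<in> hom (free_Abelian_group S) G" "u \<in> carrier (free_Abelian_group S)"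
  shows "h u = finprod G (\<lambda>p. h (frag_of p) [^]\<^bsub>G\<^esub> Poly_Mapping.lookup u p) (Poly_Mapping.keys u)"
proof -
  interpret G: comm_group G by fact
  interpret h: group_hom "free_Abelian_group S" G h
    using assms by (simp add: group_hom_def group_hom_axioms_def G.is_group)
  have gen: "h (\<Sum>p\<in>P. frag_cmul (c p) (frag_of p)) = finprod G (\<lambda>p. h (frag_of p) [^]\<^bsub>G\<^esub> c p) P
      \<and> Poly_Mapping.keys (\<Sum>p\<in>P. frag_cmul (c p) (frag_of p)) \<subseteq> S"
    if "finite P" "P \<subseteq> S" for P and c :: "_ \<Rightarrow> int"
    using that
  proof (induction P)
    case empty
    then show ?case using h.hom_one by simp
  next
    case (insert p P)
    have cl: "h (frag_of q) \<in> carrier G" if "q \<in> insert p P" for q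
      using that insert.prems by (intro h.hom_closed) auto
    have pow: "frag_cmul (c p) (frag_of p) = frag_of p [^]\<^bsub>free_Abelian_group S\<^esub> c p"
      using insert.prems by simp
    have k: "Poly_Mapping.keys (frag_cmul (c p) (frag_of p)) \<subseteq> S"
      using insert.prems keys_cmul[of "c p" "frag_of p"] by auto
    have "h (frag_cmul (c p) (frag_of p)) = h (frag_of p) [^]\<^bsub>G\<^esub> c p"
      unfolding pow using insert.prems by (intro h.hom_int_pow) auto
    moreover have "h (frag_cmul (c p) (frag_of p) + (\<Sum>p\<in>P. frag_cmul (c p) (frag_of p)))
        = h (frag_cmul (c p) (frag_of p)) \<otimes>\<^bsub>G\<^esub> h (\<Sum>p\<in>P. frag_cmul (c p) (frag_of p))"
      using h.hom_mult[of "frag_cmul (c p) (frag_of p)" "\<Sum>p\<in>P. frag_cmul (c p) (frag_of p)"]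
        k insert by simp
    moreover have "Poly_Mapping.keys (frag_cmul (c p) (frag_of p) + (\<Sum>p\<in>P. frag_cmul (c p) (frag_of p))) \<subseteq> S"
      using k insert Poly_Mapping.keys_add[of "frag_cmul (c p) (frag_of p)" "\<Sum>p\<in>P. frag_cmul (c p) (frag_of p)"] by auto
    ultimately show ?case
      using insert cl by (simp add: Pi_def)
  qed
  show ?thesis
    using gen[of "Poly_Mapping.keys u" "Poly_Mapping.lookup u"] assms(3)
      frag_expansion[of u] by (simp add: frag_extend_def)
qed


section \<open>The universal property of \<open>B \<otimes>\<^sub>A B\<close>\<close>

context dg_algebra_extension begin

abbreviation "T \<equiv> tensor_group A B \<phi>"
abbreviation "pure \<equiv> tensor_pure A B \<phi>"

definition balanced_biadditive :: "('g, 'z) monoid_scheme \<Rightarrow> ('b \<Rightarrow> 'b \<Rightarrow> 'g) \<Rightarrow> bool" where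
  "balanced_biadditive G \<beta> \<longleftrightarrow>
     (\<forall>x\<in>carrier B. \<forall>y\<in>carrier B. \<beta> x y \<in> carrier G) \<and>
     (\<forall>x\<in>carrier B. \<forall>x'\<in>carrier B. \<forall>y\<in>carrier B. \<beta> (x \<oplus>\<^bsub>B\<^esub> x') y = \<beta> x y \<otimes>\<^bsub>G\<^esub> \<beta> x' y) \<and>
     (\<forall>x\<in>carrier B. \<forall>y\<in>carrier B. \<forall>y'\<in>carrier B. \<beta> x (y \<oplus>\<^bsub>B\<^esub> y') = \<beta> x y \<otimes>\<^bsub>G\<^esub> \<beta> x y') \<and>
     (\<forall>x\<in>carrier B. \<forall>a\<in>carrier A. \<forall>y\<in>carrier B. \<beta> (x \<otimes>\<^bsub>B\<^esub> \<phi> a) y = \<beta> x (\<phi> a \<otimes>\<^bsub>B\<^esub> y))"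

lemma T_group: "group T"
  unfolding tensor_group_def by (rule normal.factorgroup_is_group[OF R_norm])

lemma T_carrier: "carrier T = (\<lambda>u. R #>\<^bsub>F\<^esub> u) ` carrier F"
  by (simp add: tensor_group_def carrier_FactGroup)

lemma coset_hom: "(\<lambda>u. R #>\<^bsub>F\<^esub> u) \<in> hom F T"
  unfolding tensor_group_def by (rule normal.r_coset_hom_Mod[OF R_norm])

lemma pure_closed: "x \<in> carrier B \<Longrightarrow> y \<in> carrier B \<Longrightarrow> pure x y \<in> carrier T"
  unfolding T_carrier tensor_pure_def by (auto intro: F_of)

lemma T_generated_by_pure:
  "carrier T = generate T {pure x y | x y. x \<in> carrier B \<and> y \<in> carrier B}" (is "_ = generate T ?P")
proof
  interpret T: group T by (rule T_group)
  interpret c: group_hom F T "\<lambda>u. R #>\<^bsub>F\<^esub> u"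
    using Fgroup T_group coset_hom by (simp add: group_hom_def group_hom_axioms_def)
  have P: "?P \<subseteq> carrier T" using pure_closed by auto
  interpret S: subgroup "generate T ?P" T by (rule T.generate_is_subgroup[OF P])
  show "generate T ?P \<subseteq> carrier T" by (rule S.subset)
  have "R #>\<^bsub>F\<^esub> u \<in> generate T ?P" if "Poly_Mapping.keys u \<subseteq> carrier B \<times> carrier B" for u
    using that
  proof (rule free_Abelian_group_induct)
    show "R #>\<^bsub>F\<^esub> 0 \<in> generate T ?P" using c.hom_one S.one_closed by (simp add: F_simps)
  next
    fix u v :: "'b \<times> 'b \<Rightarrow>\<^sub>0 int"
    assume keys: "Poly_Mapping.keys u \<subseteq> carrier B \<times> carrier B" "Poly_Mapping.keys v \<subseteq> carrier B \<times> carrier B"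
      and IH: "R #>\<^bsub>F\<^esub> u \<in> generate T ?P" "R #>\<^bsub>F\<^esub> v \<in> generate T ?P"
    then have uv: "u \<in> carrier F" "v \<in> carrier F" by (simp_all add: tensor_free_def)
    have "u - v = u \<otimes>\<^bsub>F\<^esub> inv\<^bsub>F\<^esub> v" using uv by (simp add: F_simps F_inv)
    then have "R #>\<^bsub>F\<^esub> (u - v) = (R #>\<^bsub>F\<^esub> u) \<otimes>\<^bsub>T\<^esub> inv\<^bsub>T\<^esub> (R #>\<^bsub>F\<^esub> v)"
      using uv by simp
    then show "R #>\<^bsub>F\<^esub> (u - v) \<in> generate T ?P" using IH S.m_closed S.m_inv_closed by simp
  next
    fix p assume "p \<in> carrier B \<times> carrier B"
    then show "R #>\<^bsub>F\<^esub> frag_of p \<in> generate T ?P"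
      by (cases p) (auto intro!: generate.incl simp: tensor_pure_def)
  qed
  then show "carrier T \<subseteq> generate T ?P" unfolding T_carrier by (auto simp: tensor_free_def)
qed

lemma tensor_hom_eqI:
  assumes "group G" "h \<in> hom T G" "k \<in> hom T G"
    and "\<And>x y. x \<in> carrier B \<Longrightarrow> y \<in> carrier B \<Longrightarrow> h (pure x y) = k (pure x y)"
    and "Z \<in> carrier T"
  shows "h Z = k Z"
  by (rule hom_eq_on_generate[OF T_group assms(1-3) _ _ assms(5)[unfolded T_generated_by_pure]])
    (use assms(4) pure_closed in auto)

text \<open>
  The extension of \<open>\<beta>\<close> to the free group kills the three families of relators.  The explicit sum over
  an arbitrary representative is recorded because \<open>tensor_mult\<close> is defined by such a sum.
\<close>

lemma tensor_universal:
  assumes "comm_group G" "balanced_biadditive G \<beta>"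
  obtains h where "h \<in> hom T G"
    "\<And>u. u \<in> carrier F \<Longrightarrow> h (R #>\<^bsub>F\<^esub> u) =
       finprod G (\<lambda>(x, y). \<beta> x y [^]\<^bsub>G\<^esub> Poly_Mapping.lookup u (x, y)) (Poly_Mapping.keys u)"
    "\<And>x y. x \<in> carrier B \<Longrightarrow> y \<in> carrier B \<Longrightarrow> h (pure x y) = \<beta> x y"
proof -
  interpret G: comm_group G by fact
  note bal = assms(2)[unfolded balanced_biadditive_def]
  have "(\<lambda>(x, y). \<beta> x y) ` (carrier B \<times> carrier B) \<subseteq> carrier G" using bal by auto
  from G.free_Abelian_group_universal[OF this] obtain k where
    k: "k \<in> hom F G" and k_of': "\<And>p. p \<in> carrier B \<times> carrier B \<Longrightarrow> k (frag_of p) = (\<lambda>(x, y). \<beta> x y) p"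
    unfolding tensor_free_def by metis
  have k_of: "k (frag_of (x, y)) = \<beta> x y" if "x \<in> carrier B" "y \<in> carrier B" for x y
    using k_of'[of "(x, y)"] that by simp
  interpret k: group_hom F G k
    using k Fgroup by (simp add: group_hom_def group_hom_axioms_def G.is_group)
  have k_diff: "k (u - v) = k u \<otimes>\<^bsub>G\<^esub> inv\<^bsub>G\<^esub> k v" if "u \<in> carrier F" "v \<in> carrier F" for u v
    using that k.hom_mult[of u "inv\<^bsub>F\<^esub> v"] k.hom_inv[of v] group.inv_closed[OF Fgroup, of v]
    by (simp add: F_simps F_inv)
  have cancel: "p \<otimes>\<^bsub>G\<^esub> q \<otimes>\<^bsub>G\<^esub> inv\<^bsub>G\<^esub> p \<otimes>\<^bsub>G\<^esub> inv\<^bsub>G\<^esub> q = \<one>\<^bsub>G\<^esub>"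
    if "p \<in> carrier G" "q \<in> carrier G" for p q
    using that by (simp add: G.m_assoc flip: G.inv_mult) (simp flip: G.m_assoc)
  have "tensor_generators \<subseteq> kernel F G k"
  proof
    fix u assume "u \<in> tensor_generators"
    moreover from this have "u \<in> carrier F" using generators_closed by auto
    ultimately show "u \<in> kernel F G k"
      unfolding tensor_generators_def kernel_def using bal
      by (auto simp: k_diff k_of F_of F_diff phi_closed cancel)
  qed
  then have "R \<subseteq> kernel F G k"
    unfolding tensor_rel_eq by (rule k.generate_subgroup_incl[OF _ k.subgroup_kernel])
  from k.FactGroup_universal_kernel[OF R_norm this] obtain h where
    h: "h \<in> hom T G" "\<And>u. u \<in> carrier F \<Longrightarrow> h (R #>\<^bsub>F\<^esub> u) = k u"
    unfolding tensor_group_def by blast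
  show thesis
  proof (rule that[OF h(1)])
    fix u assume u: "u \<in> carrier F"
    have keys: "Poly_Mapping.keys u \<subseteq> carrier B \<times> carrier B" using u by (simp add: tensor_free_def)
    have "h (R #>\<^bsub>F\<^esub> u) = finprod G (\<lambda>p. k (frag_of p) [^]\<^bsub>G\<^esub> Poly_Mapping.lookup u p) (Poly_Mapping.keys u)"
      using h(2)[OF u] hom_sum_frag[OF assms(1) k[unfolded tensor_free_def] u[unfolded tensor_free_def]] by simp
    also have "\<dots> = finprod G (\<lambda>(x, y). \<beta> x y [^]\<^bsub>G\<^esub> Poly_Mapping.lookup u (x, y)) (Poly_Mapping.keys u)"
      by (rule G.finprod_cong') (use keys bal in \<open>auto simp: k_of\<close>)
    finally show "h (R #>\<^bsub>F\<^esub> u) =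
       finprod G (\<lambda>(x, y). \<beta> x y [^]\<^bsub>G\<^esub> Poly_Mapping.lookup u (x, y)) (Poly_Mapping.keys u)" .
  next
    fix x y assume "x \<in> carrier B" "y \<in> carrier B"
    then show "h (pure x y) = \<beta> x y" by (simp add: tensor_pure_def h(2) k_of F_of)
  qed
qed

text \<open>
  The map out of the tensor product induced by a balanced biadditive map.  On the carrier it is unique
  (\<open>tensor_hom_eqI\<close>), so the choice is immaterial there.
\<close>

definition tensor_lift :: "('g, 'z) monoid_scheme \<Rightarrow> ('b \<Rightarrow> 'b \<Rightarrow> 'g) \<Rightarrow> ('b \<times> 'b \<Rightarrow>\<^sub>0 int) set \<Rightarrow> 'g" where
  "tensor_lift G \<beta> = (SOME h. h \<in> hom T G \<and>
     (\<forall>x\<in>carrier B. \<forall>y\<in>carrier B. h (pure x y) = \<beta> x y))"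

lemma tensor_lift:
  assumes "comm_group G" "balanced_biadditive G \<beta>"
  shows tensor_lift_hom: "tensor_lift G \<beta> \<in> hom T G"
    and tensor_lift_pure: "x \<in> carrier B \<Longrightarrow> y \<in> carrier B \<Longrightarrow> tensor_lift G \<beta> (pure x y) = \<beta> x y"
proof -
  let ?Q = "\<lambda>h. h \<in> hom T G \<and> (\<forall>x\<in>carrier B. \<forall>y\<in>carrier B. h (pure x y) = \<beta> x y)"
  have "?Q (tensor_lift G \<beta>)" unfolding tensor_lift_def
    by (rule someI_ex[of ?Q]) (use tensor_universal[OF assms] in metis)
  then show "tensor_lift G \<beta> \<in> hom T G"
    "x \<in> carrier B \<Longrightarrow> y \<in> carrier B \<Longrightarrow> tensor_lift G \<beta> (pure x y) = \<beta> x y" by auto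
qed

text \<open>
  The universal property applied to the multiplication of \<open>B\<close> shows that the sum defining
  \<open>tensor_mult\<close> has the same value at all representatives of a coset.
\<close>

lemma tensor_mult_hom_pure:
  shows tensor_mult_hom: "tensor_mult B \<in> hom T (add_monoid B)"
    and tensor_mult_pure: "x \<in> carrier B \<Longrightarrow> y \<in> carrier B \<Longrightarrow> tensor_mult B (pure x y) = x \<otimes>\<^bsub>B\<^esub> y"
proof -
  have "balanced_biadditive (add_monoid B) (monoid.mult B)"
    by (auto simp: balanced_biadditive_def B.l_distr B.r_distr B.m_assoc phi_closed)
  from tensor_universal[OF B.a_comm_group this] obtain h where
    h: "h \<in> hom T (add_monoid B)" and
    h_coset: "\<And>u. u \<in> carrier F \<Longrightarrow> h (R #>\<^bsub>F\<^esub> u) =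
       finsum B (\<lambda>(x, y). [Poly_Mapping.lookup u (x, y)] \<cdot>\<^bsub>B\<^esub> (x \<otimes>\<^bsub>B\<^esub> y)) (Poly_Mapping.keys u)" and
    h_pure: "\<And>x y. x \<in> carrier B \<Longrightarrow> y \<in> carrier B \<Longrightarrow> h (pure x y) = x \<otimes>\<^bsub>B\<^esub> y"
    unfolding finsum_def add_pow_def by blast
  have eq: "tensor_mult B Z = h Z" if Z: "Z \<in> carrier T" for Z
  proof -
    obtain u where u: "u \<in> carrier F" "Z = R #>\<^bsub>F\<^esub> u" using Z T_carrier by auto
    have same: "finsum B (\<lambda>(x, y). [Poly_Mapping.lookup v (x, y)] \<cdot>\<^bsub>B\<^esub> (x \<otimes>\<^bsub>B\<^esub> y)) (Poly_Mapping.keys v) = h Z"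
      if "v \<in> Z" for v
    proof -
      have "v \<in> carrier F"
        using that u monoid.r_coset_subset_G[OF group.is_monoid[OF Fgroup] subgroup.subset[OF R_sub]] by blast
      moreover have "Z = R #>\<^bsub>F\<^esub> v"
        using group.repr_independence[OF Fgroup _ u(1) R_sub] that u(2) by auto
      ultimately show ?thesis using h_coset by simp
    qed
    have "u \<in> Z" using group.rcos_self[OF Fgroup u(1) R_sub] u(2) by simp
    then have "(\<lambda>u. finsum B (\<lambda>(x, y). [Poly_Mapping.lookup u (x, y)] \<cdot>\<^bsub>B\<^esub> (x \<otimes>\<^bsub>B\<^esub> y))
            (Poly_Mapping.keys u)) ` Z = {h Z}"
      by (subst image_cong[OF refl same]) auto
    then show ?thesis by (simp add: tensor_mult_def)
  qed
  show "tensor_mult B \<in> hom T (add_monoid B)"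
    using h eq group.is_monoid[OF T_group] by (auto simp: hom_def Pi_def monoid.m_closed)
  show "x \<in> carrier B \<Longrightarrow> y \<in> carrier B \<Longrightarrow> tensor_mult B (pure x y) = x \<otimes>\<^bsub>B\<^esub> y"
    using eq h_pure pure_closed by auto
qed

lemma tensor_induced_hom:
  assumes "\<And>x y. x \<in> carrier B \<Longrightarrow> y \<in> carrier B \<Longrightarrow> t (x,y) \<in> carrier F"
    "\<And>u. u \<in> tensor_generators \<Longrightarrow> frag_extend t u \<in> R"
  shows "tensor_induced A B \<phi> t \<in> hom T T"
proof -
  interpret c: group_hom F T "\<lambda>u. R #>\<^bsub>F\<^esub> u"
    using Fgroup T_group coset_hom by (simp add: group_hom_def group_hom_axioms_def)
  have tF: "frag_extend t u \<in> carrier F" if "u \<in> carrier F" for u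
  proof -
    have "Poly_Mapping.keys (t p) \<subseteq> carrier B \<times> carrier B" if "p \<in> Poly_Mapping.keys u" for p
      using that \<open>u \<in> carrier F\<close> assms(1) by (cases p) (auto simp: tensor_free_def)
    then have "Poly_Mapping.keys (frag_extend t u) \<subseteq> carrier B \<times> carrier B"
      using keys_frag_extend[of t u] by blast
    then show ?thesis by (simp add: tensor_free_def)
  qed
  have ind: "tensor_induced A B \<phi> t (R #>\<^bsub>F\<^esub> u) = R #>\<^bsub>F\<^esub> frag_extend t u" if "u \<in> carrier F" for u
    by (rule tensor_induced_coset) (use assms that in auto)
  show ?thesis
  proof (rule homI)
    fix Z assume "Z \<in> carrier T"
    then show "tensor_induced A B \<phi> t Z \<in> carrier T" using ind tF by (auto simp: T_carrier)
  next
    fix Z W assume "Z \<in> carrier T" "W \<in> carrier T"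
    then obtain u v where u: "u \<in> carrier F" "Z = R #>\<^bsub>F\<^esub> u" and v: "v \<in> carrier F" "W = R #>\<^bsub>F\<^esub> v"
      by (auto simp: T_carrier)
    have "Z \<otimes>\<^bsub>T\<^esub> W = R #>\<^bsub>F\<^esub> (u + v)" using c.hom_mult[OF u(1) v(1)] u v by (simp add: F_simps)
    then have "tensor_induced A B \<phi> t (Z \<otimes>\<^bsub>T\<^esub> W) = R #>\<^bsub>F\<^esub> (frag_extend t u + frag_extend t v)"
      using ind[OF F_add[OF u(1) v(1)]] by (simp add: frag_extend_add)
    also have "\<dots> = tensor_induced A B \<phi> t Z \<otimes>\<^bsub>T\<^esub> tensor_induced A B \<phi> t W"
      using c.hom_mult[OF tF[OF u(1)] tF[OF v(1)]] u v ind by (simp add: F_simps)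
    finally show "tensor_induced A B \<phi> t (Z \<otimes>\<^bsub>T\<^esub> W) = tensor_induced A B \<phi> t Z \<otimes>\<^bsub>T\<^esub> tensor_induced A B \<phi> t W" .
  qed
qed

lemma tensor_diff_hom: "diff (dg_tensor A B \<phi>) \<in> hom T T"
  unfolding dg_tensor_def dg_ring.simps
  by (rule tensor_induced_hom)
    (use diff_generators F_add F_of B.diff_closed B.grade_involution_closed in auto)

lemma tensor_lact_hom: assumes "b \<in> carrier B" shows "lact (dg_tensor A B \<phi>) b \<in> hom T T"
  unfolding dg_tensor_def dg_module.simps
proof (rule tensor_induced_hom)
  fix u assume "u \<in> tensor_generators"
  then show "frag_extend (\<lambda>(x, y). frag_of (b \<otimes>\<^bsub>B\<^esub> x, y)) u \<in> R"
    using assms unfolding tensor_generators_def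
    by (auto simp: frag_extend_diff B.r_distr B.m_assoc[symmetric] phi_closed rel_add_left rel_add_right rel_balanced)
qed (use assms F_of in auto)

lemma tensor_ract_hom: assumes "b \<in> carrier B" shows "(\<lambda>Z. ract (dg_tensor A B \<phi>) Z b) \<in> hom T T"
  unfolding dg_tensor_def dg_bimodule.simps
proof (rule tensor_induced_hom)
  fix u assume "u \<in> tensor_generators"
  then show "frag_extend (\<lambda>(x, y). frag_of (x, y \<otimes>\<^bsub>B\<^esub> b)) u \<in> R"
    using assms unfolding tensor_generators_def
    by (auto simp: frag_extend_diff B.l_distr B.m_assoc phi_closed rel_add_left rel_add_right rel_balanced)
qed (use assms F_of in auto)

end


section \<open>Signs in differential graded modules\<close>

lemma additive_minus:
  assumes "abelian_group M" "abelian_group N" "h \<in> hom (add_monoid M) (add_monoid N)" "x \<in> carrier M"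
  shows "h (\<ominus>\<^bsub>M\<^esub> x) = \<ominus>\<^bsub>N\<^esub> h x"
proof -
  interpret h: group_hom "add_monoid M" "add_monoid N" h
    using assms by (simp add: group_hom_def group_hom_axioms_def abelian_group.a_group)
  show ?thesis using h.hom_inv assms(4) by (simp add: a_inv_def)
qed

context dg_module begin

lemma lact_hom: "a \<in> carrier A \<Longrightarrow> lact M a \<in> hom (add_monoid M) (add_monoid M)"
  by (simp add: hom_def lact_closed lact_add_right)

lemma lact_hom_left: "m \<in> carrier M \<Longrightarrow> (\<lambda>a. lact M a m) \<in> hom (add_monoid A) (add_monoid M)"
  by (simp add: hom_def lact_closed lact_add_left)

lemma lact_minus_right:
  "a \<in> carrier A \<Longrightarrow> m \<in> carrier M \<Longrightarrow> lact M a (\<ominus>\<^bsub>M\<^esub> m) = \<ominus>\<^bsub>M\<^esub> lact M a m"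
  by (rule additive_minus[OF M.abelian_group_axioms M.abelian_group_axioms lact_hom])

lemma lact_minus_left:
  "a \<in> carrier A \<Longrightarrow> m \<in> carrier M \<Longrightarrow> lact M (\<ominus>\<^bsub>A\<^esub> a) m = \<ominus>\<^bsub>M\<^esub> lact M a m"
  by (rule additive_minus[OF A.abelian_group_axioms M.abelian_group_axioms lact_hom_left])

text \<open>
  The sign in the Leibniz rule depends on the degree of the scalar alone, so the rule is additive in
  the vector and extends to inhomogeneous vectors.
\<close>

lemma lact_leibniz_right:
  assumes "a \<in> homog A i" "m \<in> carrier M"
  shows "diff M (lact M a m) = lact M (diff A a) m \<oplus>\<^bsub>M\<^esub> koszul M i (lact M a (diff M m))"
  using assms(2)
proof (induction m rule: M.homog_induct)
  case (homog j m)
  then show ?case using lact_leibniz[OF assms(1)] by simp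
next
  case (add m m')
  then show ?case using A.homog_carrier[OF assms(1)]
    by (simp add: lact_add_right M.diff_add lact_closed M.diff_closed A.diff_closed
        M.koszul_add M.koszul_closed M.a_ac)
qed

end


section \<open>Restriction of scalars\<close>

text \<open>
  The additive monoids of a module and of its restriction have different types, as the type of their
  record extension mentions the scalars, so they cannot be equated.  Everything defined from them is compared by unfolding to carrier, addition
  and zero, which do agree.
\<close>

lemma dg_restrict_simps [simp]:
  "carrier (dg_restrict \<phi> M) = carrier M"
  "ring.zero (dg_restrict \<phi> M) = ring.zero M"
  "add (dg_restrict \<phi> M) = add M"
  "homog (dg_restrict \<phi> M) = homog M"
  "diff (dg_restrict \<phi> M) = diff M"
  "lact (dg_restrict \<phi> M) a = lact M (\<phi> a)"
  by (simp_all add: dg_restrict_def)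

lemma dg_restrict_koszul [simp]: "koszul (dg_restrict \<phi> M) = koszul M"
  by (simp add: koszul_def a_inv_def m_inv_def fun_eq_iff)

lemma dg_restrict_kernel [simp]:
  "a_kernel (dg_restrict \<phi> M) (dg_restrict \<phi> N) g = a_kernel M N g"
  by (simp add: a_kernel_def kernel_def)

lemma dg_restrict_hom [simp]:
  "dg_hom (dg_restrict \<phi> M) (dg_restrict \<phi> N) = dg_hom M N"
  by (simp add: dg_hom_def hom_def)

lemma dg_group_restrict:
  assumes "dg_group M" shows "dg_group (dg_restrict \<phi> M)"
proof -
  interpret M: dg_group M by fact
  have "abelian_group (dg_restrict \<phi> M)"
    by (rule abelian_groupI) (auto simp: M.a_ac intro: M.l_neg M.a_inv_closed)
  moreover have "is_decomposition (dg_restrict \<phi> M) = is_decomposition M"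
    by (simp add: is_decomposition_def finsum_def finprod_def fun_eq_iff)
  ultimately show ?thesis
    using M.homog_subgroup M.direct_sum M.diff_additive M.diff_degree M.diff_diff
    by (simp add: dg_group_def dg_group_axioms_def additive_subgroup_def subgroup_def m_inv_def hom_def)
qed

context dg_algebra_extension begin

lemma phi_mult: "a \<in> carrier A \<Longrightarrow> b \<in> carrier A \<Longrightarrow> \<phi> (a \<otimes>\<^bsub>A\<^esub> b) = \<phi> a \<otimes>\<^bsub>B\<^esub> \<phi> b"
  and phi_one: "\<phi> \<one>\<^bsub>A\<^esub> = \<one>\<^bsub>B\<^esub>"
  using phi by (auto simp: dg_algebra_hom_def ring_hom_def)

lemma dg_module_restrict:
  assumes "dg_module B M" shows "dg_module A (dg_restrict \<phi> M)"
proof -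
  interpret M: dg_module B M by fact
  have "dg_module_axioms A (dg_restrict \<phi> M)"
    by unfold_locales
      (simp_all add: phi_closed phi_add phi_mult phi_one phi_homog M.lact_closed M.lact_add_left
        M.lact_add_right M.lact_assoc M.lact_one M.lact_homog M.lact_leibniz phi_diff[symmetric]
        A.homog_carrier)
  then show ?thesis
    using dg_group_restrict[OF M.M.dg_group_axioms] A.dg_algebra_axioms by (simp add: dg_module_def)
qed

lemma dg_module_hom_restrict:
  "h \<in> dg_module_hom B M N \<Longrightarrow> h \<in> dg_module_hom A (dg_restrict \<phi> M) (dg_restrict \<phi> N)"
  by (simp add: dg_module_hom_def phi_closed)

lemma dg_short_exact_restrict:
  "dg_short_exact B L M N f g \<Longrightarrow>
    dg_short_exact A (dg_restrict \<phi> L) (dg_restrict \<phi> M) (dg_restrict \<phi> N) f g"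
  by (simp add: dg_short_exact_def dg_module_restrict dg_module_hom_restrict)

lemma dg_split_short_exact_restrict:
  "dg_split_short_exact B L M N f g \<Longrightarrow>
    dg_split_short_exact A (dg_restrict \<phi> L) (dg_restrict \<phi> M) (dg_restrict \<phi> N) f g"
  unfolding dg_split_short_exact_def using dg_short_exact_restrict dg_module_hom_restrict by fastforce

end


section \<open>Transporting sections along a separability element\<close>

text \<open>
  Averaging makes sense for an arbitrary morphism \<open>s\<close> over \<open>A\<close> between modules over \<open>B\<close>; that the
  average of a section of \<open>g\<close> is again one is \<open>average_section\<close>.
\<close>

locale restricted_morphism = dg_algebra_extension A B \<phi> + M: dg_module B M + N: dg_module B N
  for A :: "('a, 'x) dg_ring_scheme" and B :: "('b, 'y) dg_ring_scheme" and \<phi>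
    and M :: "('b, 'm) dg_module" and N :: "('b, 'n) dg_module" +
  fixes s assumes s: "s \<in> dg_module_hom A (dg_restrict \<phi> N) (dg_restrict \<phi> M)"
begin

lemma s_closed: "n \<in> carrier N \<Longrightarrow> s n \<in> carrier M"
  and s_add: "n \<in> carrier N \<Longrightarrow> n' \<in> carrier N \<Longrightarrow> s (n \<oplus>\<^bsub>N\<^esub> n') = s n \<oplus>\<^bsub>M\<^esub> s n'"
  and s_homog: "n \<in> homog N i \<Longrightarrow> s n \<in> homog M i"
  and s_diff: "n \<in> carrier N \<Longrightarrow> s (diff N n) = diff M (s n)"
  and s_phi: "a \<in> carrier A \<Longrightarrow> n \<in> carrier N \<Longrightarrow> s (lact N (\<phi> a) n) = lact M (\<phi> a) (s n)"
  using s by (auto simp: dg_module_hom_def dg_hom_def hom_def)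

lemma s_minus: "n \<in> carrier N \<Longrightarrow> s (\<ominus>\<^bsub>N\<^esub> n) = \<ominus>\<^bsub>M\<^esub> s n"
  by (rule additive_minus[OF N.abelian_group_axioms M.abelian_group_axioms])
    (auto simp: hom_def s_closed s_add)

text \<open>
  The analogue of averaging over a group: $Z = \sum x_k \otimes y_k$ turns \<open>s\<close> into
  $n \mapsto \sum x_k\, s(y_k n)$.
\<close>

definition average :: "('b \<times> 'b \<Rightarrow>\<^sub>0 int) set \<Rightarrow> 'n \<Rightarrow> 'm" where
  "average Z n = tensor_lift (add_monoid M) (\<lambda>x y. lact M x (s (lact N y n))) Z"

text \<open>This is where linearity of \<open>s\<close> over \<open>A\<close> is used: it moves \<open>\<phi> a\<close> across the tensor sign.\<close>

lemma balanced_average: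
  "n \<in> carrier N \<Longrightarrow> balanced_biadditive (add_monoid M) (\<lambda>x y. lact M x (s (lact N y n)))"
  by (simp add: balanced_biadditive_def M.lact_closed N.lact_closed s_closed M.lact_add_left
      M.lact_add_right N.lact_add_left s_add M.lact_assoc N.lact_assoc s_phi phi_closed)

lemma average_hom: "n \<in> carrier N \<Longrightarrow> (\<lambda>Z. average Z n) \<in> hom T (add_monoid M)"
  unfolding average_def by (rule tensor_lift_hom[OF M.a_comm_group balanced_average])

lemma average_pure:
  "x \<in> carrier B \<Longrightarrow> y \<in> carrier B \<Longrightarrow> n \<in> carrier N \<Longrightarrow>
    average (pure x y) n = lact M x (s (lact N y n))"
  unfolding average_def by (rule tensor_lift_pure[OF M.a_comm_group balanced_average])

lemma average_closed: "Z \<in> carrier T \<Longrightarrow> n \<in> carrier N \<Longrightarrow> average Z n \<in> carrier M"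
  using average_hom by (auto simp: hom_def)

lemma average_add:
  assumes "Z \<in> carrier T" "n \<in> carrier N" "n' \<in> carrier N"
  shows "average Z (n \<oplus>\<^bsub>N\<^esub> n') = average Z n \<oplus>\<^bsub>M\<^esub> average Z n'"
proof (rule tensor_hom_eqI[OF M.a_group])
  show "(\<lambda>Z. average Z (n \<oplus>\<^bsub>N\<^esub> n')) \<in> hom T (add_monoid M)"
    using assms by (intro average_hom) simp
  show "(\<lambda>Z. average Z n \<oplus>\<^bsub>M\<^esub> average Z n') \<in> hom T (add_monoid M)"
    using comm_group.hom_group_mult[OF M.a_comm_group average_hom[OF assms(2)] average_hom[OF assms(3)]]
    by simp
  show "average (pure x y) (n \<oplus>\<^bsub>N\<^esub> n') = average (pure x y) n \<oplus>\<^bsub>M\<^esub> average (pure x y) n'"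
    if "x \<in> carrier B" "y \<in> carrier B" for x y
    using assms that
    by (simp add: average_pure N.lact_add_right s_add M.lact_add_right s_closed N.lact_closed)
qed (rule assms)

lemma average_lact:
  assumes "Z \<in> carrier T" "b \<in> carrier B" "n \<in> carrier N"
  shows "average (lact (dg_tensor A B \<phi>) b Z) n = lact M b (average Z n)"
proof (rule tensor_hom_eqI[OF M.a_group])
  show "(\<lambda>Z. average (lact (dg_tensor A B \<phi>) b Z) n) \<in> hom T (add_monoid M)"
    using hom_compose[OF tensor_lact_hom[OF assms(2)] average_hom[OF assms(3)]] by (simp add: comp_def)
  show "(\<lambda>Z. lact M b (average Z n)) \<in> hom T (add_monoid M)"
    using hom_compose[OF average_hom[OF assms(3)] M.lact_hom[OF assms(2)]] by (simp add: comp_def)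
  show "average (lact (dg_tensor A B \<phi>) b (pure x y)) n = lact M b (average (pure x y) n)"
    if "x \<in> carrier B" "y \<in> carrier B" for x y
    using assms that
    by (simp add: tensor_lact_pure average_pure M.lact_assoc s_closed N.lact_closed)
qed (rule assms)

text \<open>
  Right multiplication on the tensor acts on the argument of the averaged map.  Together with
  \<open>average_lact\<close> it makes averaging along a \<open>B\<close>-central tensor \<open>B\<close>-linear.
\<close>

lemma average_ract:
  assumes "Z \<in> carrier T" "b \<in> carrier B" "n \<in> carrier N"
  shows "average (ract (dg_tensor A B \<phi>) Z b) n = average Z (lact N b n)"
proof (rule tensor_hom_eqI[OF M.a_group])
  show "(\<lambda>Z. average (ract (dg_tensor A B \<phi>) Z b) n) \<in> hom T (add_monoid M)"
    using hom_compose[OF tensor_ract_hom[OF assms(2)] average_hom[OF assms(3)]] by (simp add: comp_def)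
  show "(\<lambda>Z. average Z (lact N b n)) \<in> hom T (add_monoid M)"
    by (rule average_hom) (use assms in \<open>simp add: N.lact_closed\<close>)
  show "average (ract (dg_tensor A B \<phi>) (pure x y) b) n = average (pure x y) (lact N b n)"
    if "x \<in> carrier B" "y \<in> carrier B" for x y
    using assms that
    by (simp add: tensor_ract_pure average_pure N.lact_assoc N.lact_closed)
qed (rule assms)

text \<open>Since \<open>g\<close> is \<open>B\<close>-linear and \<open>s\<close> is a section, $g(x\, s(y n)) = x\, g(s(y n)) = (x y) n$.\<close>

lemma average_section:
  assumes g: "g \<in> dg_module_hom B M N" and sec: "\<And>n. n \<in> carrier N \<Longrightarrow> g (s n) = n"
    and "Z \<in> carrier T" "n \<in> carrier N"
  shows "g (average Z n) = lact N (tensor_mult B Z) n"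
proof (rule tensor_hom_eqI[OF N.a_group])
  have g_hom: "g \<in> hom (add_monoid M) (add_monoid N)" using g by (simp add: dg_module_hom_def dg_hom_def)
  show "(\<lambda>Z. g (average Z n)) \<in> hom T (add_monoid N)"
    using hom_compose[OF average_hom[OF assms(4)] g_hom] by (simp add: comp_def)
  show "(\<lambda>Z. lact N (tensor_mult B Z) n) \<in> hom T (add_monoid N)"
    using hom_compose[OF tensor_mult_hom N.lact_hom_left[OF assms(4)]] by (simp add: comp_def)
  show "g (average (pure x y) n) = lact N (tensor_mult B (pure x y)) n"
    if "x \<in> carrier B" "y \<in> carrier B" for x y
    using assms(4) that g
    by (simp add: average_pure tensor_mult_pure dg_module_hom_def s_closed sec N.lact_closed N.lact_assoc)
qed (rule assms)

lemma tensor_homog_closed: "Z \<in> homog (dg_tensor A B \<phi>) k \<Longrightarrow> Z \<in> carrier T"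
  unfolding dg_tensor_def dg_ring.simps
  by (rule group.generate_in_carrier[OF T_group]) (auto intro: pure_closed B.homog_carrier)

lemma average_homog:
  assumes "Z \<in> homog (dg_tensor A B \<phi>) k" "n \<in> homog N i"
  shows "average Z n \<in> homog M (k + i)"
proof -
  have n: "n \<in> carrier N" using assms(2) N.homog_carrier by auto
  let ?P = "{pure x y | x y. \<exists>i j. x \<in> homog B i \<and> y \<in> homog B j \<and> i + j = k}"
  interpret h: group_hom T "add_monoid M" "\<lambda>Z. average Z n"
    using T_group M.a_group average_hom[OF n] by (simp add: group_hom_def group_hom_axioms_def)
  have P: "?P \<subseteq> carrier T" by (auto intro: pure_closed B.homog_carrier)
  have "average (pure x y) n \<in> homog M (k + i)" if "x \<in> homog B i'" "y \<in> homog B j" "i' + j = k" for x y i' j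
  proof -
    have "lact M x (s (lact N y n)) \<in> homog M (i' + (j + i))"
      using that assms(2) by (intro M.lact_homog s_homog N.lact_homog)
    then show ?thesis using that n by (simp add: average_pure B.homog_carrier add.assoc[symmetric])
  qed
  then have "(\<lambda>Z. average Z n) ` ?P \<subseteq> homog M (k + i)" by auto
  then have "generate (add_monoid M) ((\<lambda>Z. average Z n) ` ?P) \<subseteq> homog M (k + i)"
    using group.generate_subgroup_incl[OF M.a_group] M.homog_subgroup by (auto simp: additive_subgroup_def)
  moreover have "average Z n \<in> (\<lambda>Z. average Z n) ` generate T ?P"
    using assms(1) by (intro imageI) (simp add: dg_tensor_def)
  ultimately show ?thesis using h.generate_img[OF P] by blast
qed

text \<open>
  On a pure tensor of bidegree $(i, j)$ the two Leibniz rules give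
  $d(x\, s(y n)) = dx\, s(y n) + (-1)^i x\, s(dy\, n) + (-1)^{i+j} x\, s(y\, dn)$.  The first two terms
  are the average along $d(x \otimes y)$, and in total degree zero the last one has no sign.  The claim
  is therefore tested on the homogeneous pure tensors generating that degree.
\<close>

lemma average_diff:
  assumes Z: "Z \<in> homog (dg_tensor A B \<phi>) 0" and n: "n \<in> carrier N"
  shows "diff M (average Z n) =
    average (diff (dg_tensor A B \<phi>) Z) n \<oplus>\<^bsub>M\<^esub> average Z (diff N n)"
proof (rule hom_eq_on_generate[OF T_group M.a_group])
  let ?P = "{pure x y | x y. \<exists>i j. x \<in> homog B i \<and> y \<in> homog B j \<and> i + j = 0}"
  have dn: "diff N n \<in> carrier N" using n by (rule N.diff_closed)
  show "(\<lambda>Z. diff M (average Z n)) \<in> hom T (add_monoid M)"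
    using hom_compose[OF average_hom[OF n] M.diff_additive] by (simp add: comp_def)
  show "(\<lambda>Z. average (diff (dg_tensor A B \<phi>) Z) n \<oplus>\<^bsub>M\<^esub> average Z (diff N n)) \<in> hom T (add_monoid M)"
    using comm_group.hom_group_mult[OF M.a_comm_group
        hom_compose[OF tensor_diff_hom average_hom[OF n]] average_hom[OF dn]]
    by (simp add: comp_def)
  show "?P \<subseteq> carrier T" by (auto intro: pure_closed B.homog_carrier)
  show "Z \<in> generate T ?P" using Z by (simp add: dg_tensor_def)
  show "diff M (average W n) = average (diff (dg_tensor A B \<phi>) W) n \<oplus>\<^bsub>M\<^esub> average W (diff N n)"
    if "W \<in> ?P" for W
  proof -
    from that obtain x y i j where W: "W = pure x y" and xh: "x \<in> homog B i" and yh: "y \<in> homog B j"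
      and ij: "i + j = 0" by auto
    have x: "x \<in> carrier B" and y: "y \<in> carrier B" using xh yh B.homog_carrier by auto
    have par: "even i \<longleftrightarrow> even j" using ij by presburger
    let ?m = "s (lact N y n)" and ?p = "s (lact N (diff B y) n)" and ?q = "s (lact N y (diff N n))"
    have mc: "lact N y n \<in> carrier N" "lact N (diff B y) n \<in> carrier N" "lact N y (diff N n) \<in> carrier N"
      using x y n dn by (simp_all add: N.lact_closed B.diff_closed)
    have "diff M ?m = s (diff N (lact N y n))" using mc by (simp add: s_diff)
    also have "\<dots> = ?p \<oplus>\<^bsub>M\<^esub> koszul M j ?q"
      using mc by (simp add: N.lact_leibniz_right[OF yh n] s_add N.koszul_closed) (simp add: koszul_def s_minus)
    finally have dm: "diff M ?m = ?p \<oplus>\<^bsub>M\<^esub> koszul M j ?q" .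
    have "diff M (average W n) = lact M (diff B x) ?m \<oplus>\<^bsub>M\<^esub> koszul M i (lact M x (?p \<oplus>\<^bsub>M\<^esub> koszul M j ?q))"
      using x y n mc by (simp add: W average_pure M.lact_leibniz_right[OF xh] s_closed dm)
    also have "\<dots> = lact M (diff B x) ?m \<oplus>\<^bsub>M\<^esub> lact M (koszul B i x) ?p \<oplus>\<^bsub>M\<^esub> lact M x ?q"
      using x mc par
      by (simp add: koszul_def s_closed M.lact_add_right M.lact_closed M.lact_minus_left
          M.lact_minus_right M.minus_add M.a_assoc B.diff_closed)
    also have "lact M (diff B x) ?m \<oplus>\<^bsub>M\<^esub> lact M (koszul B i x) ?p =
        average (pure (diff B x) y \<otimes>\<^bsub>T\<^esub> pure (koszul B i x) (diff B y)) n"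
      using x y n hom_mult[OF average_hom[OF n], of "pure (diff B x) y" "pure (koszul B i x) (diff B y)"]
      by (simp add: average_pure pure_closed B.diff_closed B.koszul_closed)
    also have "pure (diff B x) y \<otimes>\<^bsub>T\<^esub> pure (koszul B i x) (diff B y) = diff (dg_tensor A B \<phi>) W"
      unfolding W tensor_diff_pure[OF xh y] by (simp add: dg_tensor_def)
    also have "lact M x ?q = average W (diff N n)" using x y dn by (simp add: W average_pure)
    finally show ?thesis .
  qed
qed

text \<open>
  Degree zero makes the averaged map graded and, for a cycle, compatible with the differentials;
  centrality makes it linear over \<open>B\<close>.
\<close>

lemma average_dg_module_hom:
  assumes "Z \<in> homog (dg_tensor A B \<phi>) 0"
    and cycle: "diff (dg_tensor A B \<phi>) Z = \<one>\<^bsub>T\<^esub>"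
    and central: "\<And>b. b \<in> carrier B \<Longrightarrow>
      lact (dg_tensor A B \<phi>) b Z = ract (dg_tensor A B \<phi>) Z b"
  shows "average Z \<in> dg_module_hom B N M"
proof -
  have Z: "Z \<in> carrier T" using assms(1) by (rule tensor_homog_closed)
  have "diff M (average Z n) = average Z (diff N n)" if n: "n \<in> carrier N" for n
  proof -
    have "average \<one>\<^bsub>T\<^esub> n = \<zero>\<^bsub>M\<^esub>"
      using hom_one[OF average_hom[OF n] T_group M.a_group] by simp
    then show ?thesis
      using average_diff[OF assms(1) n] average_closed[OF Z] N.diff_closed[OF n] by (simp add: cycle)
  qed
  moreover have "average Z (lact N b n) = lact M b (average Z n)" if "b \<in> carrier B" "n \<in> carrier N" for b n
    using average_lact[OF Z that] average_ract[OF Z that] central[OF that(1)] by simp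
  moreover have "average Z n \<in> homog M i" if "n \<in> homog N i" for n i
    using average_homog[OF assms(1) that] by simp
  ultimately show ?thesis
    using Z by (simp add: dg_module_hom_def dg_hom_def hom_def average_closed average_add)
qed

end

context dg_algebra_extension begin

text \<open>
  The image of the unit under a splitting $\rho$ of the multiplication: it is a cycle because
  $d(1) = 0$, and it is central because $b\,\rho(1) = \rho(b) = \rho(1)\,b$.
\<close>

lemma separability_element:
  assumes "dg_separable A B \<phi>"
  obtains e where "e \<in> homog (dg_tensor A B \<phi>) 0" "diff (dg_tensor A B \<phi>) e = \<one>\<^bsub>T\<^esub>"
    "\<And>b. b \<in> carrier B \<Longrightarrow> lact (dg_tensor A B \<phi>) b e = ract (dg_tensor A B \<phi>) e b"
    "tensor_mult B e = \<one>\<^bsub>B\<^esub>"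
proof -
  obtain \<rho> where \<rho>: "\<rho> \<in> dg_bimodule_hom B B (dg_regular B) (dg_tensor A B \<phi>)"
    and sec: "\<And>b. b \<in> carrier B \<Longrightarrow> tensor_mult B (\<rho> b) = b"
    using assms by (auto simp: dg_separable_def)
  have \<rho>_hom: "\<rho> \<in> hom (add_monoid B) T"
    and \<rho>_homog: "\<And>x i. x \<in> homog B i \<Longrightarrow> \<rho> x \<in> homog (dg_tensor A B \<phi>) i"
    and \<rho>_diff: "\<And>x. x \<in> carrier B \<Longrightarrow> \<rho> (diff B x) = diff (dg_tensor A B \<phi>) (\<rho> x)"
    and \<rho>_lact: "\<And>b x. b \<in> carrier B \<Longrightarrow> x \<in> carrier B \<Longrightarrow> \<rho> (b \<otimes>\<^bsub>B\<^esub> x) = lact (dg_tensor A B \<phi>) b (\<rho> x)"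
    and \<rho>_ract: "\<And>b x. b \<in> carrier B \<Longrightarrow> x \<in> carrier B \<Longrightarrow> \<rho> (x \<otimes>\<^bsub>B\<^esub> b) = ract (dg_tensor A B \<phi>) (\<rho> x) b"
    using \<rho> by (auto simp: dg_bimodule_hom_def dg_module_hom_def dg_hom_def dg_regular_def hom_def dg_tensor_def)
  \<comment> \<open>The Leibniz rule for $1 \cdot 1$ reads $d(1) = d(1) + d(1)$.\<close>
  have d1: "diff B \<one>\<^bsub>B\<^esub> = \<zero>\<^bsub>B\<^esub>"
    using B.leibniz[OF B.one_homog B.one_homog] B.diff_closed[OF B.one_closed]
    by (simp add: koszul_def)
  show thesis
  proof (rule that[of "\<rho> \<one>\<^bsub>B\<^esub>"])
    show "\<rho> \<one>\<^bsub>B\<^esub> \<in> homog (dg_tensor A B \<phi>) 0" by (rule \<rho>_homog[OF B.one_homog])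
    show "diff (dg_tensor A B \<phi>) (\<rho> \<one>\<^bsub>B\<^esub>) = \<one>\<^bsub>T\<^esub>"
      using \<rho>_diff[OF B.one_closed] hom_one[OF \<rho>_hom B.a_group T_group] d1 by simp
    show "lact (dg_tensor A B \<phi>) b (\<rho> \<one>\<^bsub>B\<^esub>) = ract (dg_tensor A B \<phi>) (\<rho> \<one>\<^bsub>B\<^esub>) b"
      if "b \<in> carrier B" for b
      using \<rho>_lact[OF that B.one_closed] \<rho>_ract[OF that B.one_closed] that by simp
    show "tensor_mult B (\<rho> \<one>\<^bsub>B\<^esub>) = \<one>\<^bsub>B\<^esub>" by (rule sec[OF B.one_closed])
  qed
qed

lemma dg_split_short_exact_of_restrict:
  assumes "dg_separable A B \<phi>" "dg_short_exact B L M N f g"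
    and "dg_split_short_exact A (dg_restrict \<phi> L) (dg_restrict \<phi> M) (dg_restrict \<phi> N) f g"
  shows "dg_split_short_exact B L M N f g"
proof -
  have mods: "dg_module B M" "dg_module B N" and g: "g \<in> dg_module_hom B M N"
    using assms(2) by (auto simp: dg_short_exact_def)
  obtain s where s: "s \<in> dg_module_hom A (dg_restrict \<phi> N) (dg_restrict \<phi> M)"
    and gs: "\<And>n. n \<in> carrier N \<Longrightarrow> g (s n) = n"
    using assms(3) by (auto simp: dg_split_short_exact_def)
  interpret restricted_morphism A B \<phi> M N s
    using mods s dg_algebra_extension_axioms
    by (simp add: restricted_morphism_def restricted_morphism_axioms_def)
  obtain e where e: "e \<in> homog (dg_tensor A B \<phi>) 0" "diff (dg_tensor A B \<phi>) e = \<one>\<^bsub>T\<^esub>"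
    "\<And>b. b \<in> carrier B \<Longrightarrow> lact (dg_tensor A B \<phi>) b e = ract (dg_tensor A B \<phi>) e b"
    "tensor_mult B e = \<one>\<^bsub>B\<^esub>"
    using separability_element[OF assms(1)] by blast
  have "average e \<in> dg_module_hom B N M" by (rule average_dg_module_hom[OF e(1-3)])
  moreover have "g (average e n) = n" if "n \<in> carrier N" for n
    using average_section[OF g gs tensor_homog_closed[OF e(1)] that] e(4) N.lact_one[OF that] by simp
  ultimately show ?thesis using assms(2) by (auto simp: dg_split_short_exact_def)
qed

end


theorem theorem4p6:
  fixes K :: "'k dg_ring" and A :: "'a dg_ring" and B :: "'b dg_ring"
    and \<iota>\<^sub>A :: "'k \<Rightarrow> 'a" and \<iota>\<^sub>B :: "'k \<Rightarrow> 'b" and \<phi> :: "'a \<Rightarrow> 'b"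
    and L :: "('b, 'l) dg_module" and M :: "('b, 'm) dg_module" and N :: "('b, 'n) dg_module"
    and f :: "'l \<Rightarrow> 'm" and g :: "'m \<Rightarrow> 'n"
  assumes "dg_division_ring K" and "graded_commutative K"
    and "dg_algebra_over K A \<iota>\<^sub>A" and "dg_algebra_over K B \<iota>\<^sub>B"
    and "dg_extension K A \<iota>\<^sub>A B \<iota>\<^sub>B \<phi>"
    and "dg_separable A B \<phi>"
    and "dg_short_exact B L M N f g"
  shows "dg_split_short_exact B L M N f g \<longleftrightarrow>
    dg_split_short_exact A (dg_restrict \<phi> L) (dg_restrict \<phi> M) (dg_restrict \<phi> N) f g"
proof -
  interpret dg_algebra_extension A B \<phi>
    using assms(3-5)
    by (simp add: dg_algebra_extension_def dg_algebra_extension_axioms_def dg_algebra_over_def dg_extension_def)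
  show ?thesis
    using dg_split_short_exact_restrict dg_split_short_exact_of_restrict[OF assms(6,7)] by blast
qed

end
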